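(* Let $G$ be the path on vertices $1,\dots,n$, let $q=3$, and let $\Omega$ be the set of proper $3$-colorings of $G$. Let $\mathcal{M}_{\rightarrow}$ be the systematic scan on $\Omega$. Then, as $n\to\infty$, $$\mathrm{Mix}\left(\mathcal{M}_{\rightarrow},\tfrac12\right)\ \ge\ \pi^{-2}\,n^2\ln n-O(n^2).$$
   Context: The $n$-vertex path has vertices $1,\dots,n$ and edges $\{i,i+1\}$. A $q$-coloring is a vector $\sigma=(\sigma_1,\dots,\sigma_n)\in\{0,\dots,q-1\}^n$; it is proper if adjacent vertices receive different colors. The procedure Metropolis($v$): choose a color $c\in\{0,\dots,q-1\}$ uniformly at random and propose recoloring $v$ with $c$; the proposal is accepted if and only if $c$ is not used at any neighbor of $v$ (otherwise the coloring is unchanged). One step of the Markov chain $\mathcal{M}_{\rightarrow}$ (systematic scan): for $v=1,2,\dots,n$ in this order, do Metropolis($v$) (with independent color choices). Thus one step is a full sweep of $n$ vertex updates. Its stationary distribution is uniform on $\Omega$. For a Markov chain $\mathcal{M}$ with transition matrix $P$ and stationary distribution $\pi$, $\mathrm{Mix}_x(\mathcal{M},\varepsilon)=\min\{t>0:\mathrm{d_{TV}}(P^t(x,\cdot),\pi(\cdot))\le\varepsilon\}$ and $\mathrm{Mix}(\mathcal{M},\varepsilon)=\max_x\mathrm{Mix}_x(\mathcal{M},\varepsilon)$, where $\mathrm{d_{TV}}(\theta_1,\theta_2)=\frac12\sum_i|\theta_1(i)-\theta_2(i)|$. In the bound, $\pi$ is the numerical constant. *)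

theory Defs
  imports "HOL-Probability.Probability" "HOL-Library.Landau_Symbols"
begin

text \<open>A finite Markov chain is given by its kernel \<open>P :: 'a \<Rightarrow> 'a pmf\<close>, where \<open>pmf (P x) y\<close> is the
  \<open>(x, y)\<close> entry of the transition matrix, together with a finite set of states \<open>S\<close>.\<close>

primrec kernel_power :: "('a \<Rightarrow> 'a pmf) \<Rightarrow> nat \<Rightarrow> 'a \<Rightarrow> 'a pmf" where
  "kernel_power P 0 x = return_pmf x"
| "kernel_power P (Suc t) x = bind_pmf (P x) (kernel_power P t)"

definition tv_dist :: "'a set \<Rightarrow> 'a pmf \<Rightarrow> 'a pmf \<Rightarrow> real" where
  "tv_dist S p r = (1/2) * (\<Sum>i\<in>S. \<bar>pmf p i - pmf r i\<bar>)"

definition mix_from :: "'a set \<Rightarrow> ('a \<Rightarrow> 'a pmf) \<Rightarrow> 'a pmf \<Rightarrow> real \<Rightarrow> 'a \<Rightarrow> nat" where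
  "mix_from S P \<mu> \<epsilon> x = (LEAST t. t > 0 \<and> tv_dist S (kernel_power P t x) \<mu> \<le> \<epsilon>)"

definition mix :: "'a set \<Rightarrow> ('a \<Rightarrow> 'a pmf) \<Rightarrow> 'a pmf \<Rightarrow> real \<Rightarrow> nat" where
  "mix S P \<mu> \<epsilon> = Max (mix_from S P \<mu> \<epsilon> ` S)"

definition path_edges :: "nat \<Rightarrow> nat set set" where
  "path_edges n = {{i, i + 1} | i. 1 \<le> i \<and> i < n}"

text \<open>A colouring \<open>(\<sigma>\<^sub>1, \<dots>, \<sigma>\<^sub>n)\<close> is a function on \<open>{1..n}\<close>, made unique by being
  \<^const>\<open>undefined\<close> elsewhere.\<close>

definition proper_colorings :: "nat \<Rightarrow> nat \<Rightarrow> (nat \<Rightarrow> nat) set" where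
  "proper_colorings q n =
     {\<sigma> \<in> {1..n} \<rightarrow>\<^sub>E {0..<q}. \<forall>u v. {u, v} \<in> path_edges n \<longrightarrow> \<sigma> u \<noteq> \<sigma> v}"

definition metropolis :: "nat \<Rightarrow> nat \<Rightarrow> nat \<Rightarrow> (nat \<Rightarrow> nat) \<Rightarrow> (nat \<Rightarrow> nat) pmf" where
  "metropolis q n v \<sigma> =
     map_pmf (\<lambda>c. if \<forall>u. {u, v} \<in> path_edges n \<longrightarrow> \<sigma> u \<noteq> c then \<sigma>(v := c) else \<sigma>)
       (pmf_of_set {0..<q})"

definition systematic_scan :: "nat \<Rightarrow> nat \<Rightarrow> (nat \<Rightarrow> nat) \<Rightarrow> (nat \<Rightarrow> nat) pmf" where
  "systematic_scan q n \<sigma> =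
     fold (\<lambda>v p. bind_pmf p (metropolis q n v)) [1..<n + 1] (return_pmf \<sigma>)"

end

theory Submission
  imports Defs "HOL-Real_Asymp.Real_Asymp"
begin

text \<open>
  Neighboring colors of a proper 3-coloring differ by \<open>\<plusminus>1\<close> modulo \<open>3\<close>, which describes the coloring, up
  to the first color, by \<open>n - 1\<close> signs. A Metropolis update at an interior vertex exchanges the two
  adjacent signs with probability \<open>1/3\<close>, and an update at an end of the path changes the outermost sign
  with probability \<open>1/3\<close> (\<open>expectation_metropolis\<close>, \<open>ascent_flip\<close>). Hence the mean of a linear
  functional of the signs evolves linearly, by the averaging operators \<open>avg_weight\<close> acting on its
  weights.

  The lower bound is Wilson's method (\<open>tv_dist_eigenfunction_gt_half\<close>): a functional \<open>\<Phi>\<close> whose weights \<open>f\<close> form an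
  eigenvector of the sweep has mean \<open>m\<^sup>t \<Phi>(x)\<close> after \<open>t\<close> sweeps from \<open>x\<close> and mean \<open>0\<close> under the stationary
  distribution, so the chain is not mixed while \<open>m\<^sup>t \<Phi>(x)\<close> exceeds the standard deviations. For the variance no
  analysis of correlations within a sweep is needed: the variance created by
  an update is at most twice the decrease of the squared Euclidean norm of the weights
  (\<open>metropolis_moments\<close>). These bounds telescope, so the variance is always at most twice the squared norm of \<open>f\<close>.

  The sweep has an explicit positive eigenvector (\<open>scan_eigenvector_is_eigenvector\<close>), namely
  \<open>f i = s\<^bsup>-i\<^esup> (sin (\<theta> i) + 3 s sin (\<theta> (i - 1)))\<close> with \<open>\<theta> = \<pi> / (n - 1)\<close> and \<open>3 s\<^sup>2 = 2 s cos \<theta> + 1\<close>,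
  whose eigenvalue is \<open>m = s\<^sup>2\<close>, about \<open>1 - \<theta>\<^sup>2 / 2\<close>. Started with all signs \<open>+1\<close>, the functional is of
  order \<open>n\<close>, and its standard deviation is of order \<open>\<surd>n\<close>; so the chain is not mixed as long as
  \<open>m\<^bsup>2 t\<^esup>\<close> exceeds a constant multiple of \<open>1 / n\<close>, that is, until about \<open>t = n\<^sup>2 ln n / \<pi>\<^sup>2\<close>.

  The mixing time is a least element, and a lower bound for it presupposes that the chain
  gets close to the uniform distribution at all. This follows from Doeblin's condition
  (\<open>tv_dist_eventually_small\<close>), since the proper 3-colorings are connected under single
  recolorings (\<open>scan_irreducible\<close>).
\<close>

section \<open>Expectations and powers of finite kernels\<close>

text \<open>The kernels considered here preserve a finite set \<open>S\<close>. Expectations are then finite sums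
  over \<open>S\<close>, so no integrability of \<open>\<phi>\<close> has to be tracked, and properties of \<open>\<phi>\<close> matter only on \<open>S\<close>.\<close>

lemma expectation_eq_sum:
  fixes \<phi> :: "'a \<Rightarrow> real"
  assumes "finite S" "set_pmf p \<subseteq> S"
  shows "measure_pmf.expectation p \<phi> = (\<Sum>x\<in>S. pmf p x * \<phi> x)"
  using assms by (subst integral_measure_pmf_real[of S]) (auto simp: mult.commute)

lemma expectation_bind:
  fixes \<phi> :: "'a \<Rightarrow> real"
  assumes "finite S" "set_pmf p \<subseteq> S" "\<And>x. x \<in> S \<Longrightarrow> set_pmf (K x) \<subseteq> S"
  shows "measure_pmf.expectation (bind_pmf p K) \<phi>
       = measure_pmf.expectation p (\<lambda>x. measure_pmf.expectation (K x) \<phi>)"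
  using assms
  by (subst pmf_expectation_bind[of S])
     (auto simp: expectation_eq_sum[of S] intro: finite_subset)

lemma expectation_mono:
  fixes \<phi> \<psi> :: "'a \<Rightarrow> real"
  assumes "finite S" "set_pmf p \<subseteq> S" "\<And>x. x \<in> S \<Longrightarrow> \<phi> x \<le> \<psi> x"
  shows "measure_pmf.expectation p \<phi> \<le> measure_pmf.expectation p \<psi>"
  using assms by (auto simp: expectation_eq_sum[of S] intro!: sum_mono mult_left_mono)

lemma expectation_cong:
  fixes \<phi> \<psi> :: "'a \<Rightarrow> real"
  assumes "finite S" "set_pmf p \<subseteq> S" "\<And>x. x \<in> S \<Longrightarrow> \<phi> x = \<psi> x"
  shows "measure_pmf.expectation p \<phi> = measure_pmf.expectation p \<psi>"
  using assms by (simp add: expectation_eq_sum[of S])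

lemma expectation_affine:
  fixes \<phi> :: "'a \<Rightarrow> real"
  assumes "finite S" "set_pmf p \<subseteq> S"
  shows "measure_pmf.expectation p (\<lambda>x. a * \<phi> x + b) = a * measure_pmf.expectation p \<phi> + b"
proof -
  have "sum (pmf p) S = 1" by (rule sum_pmf_eq_1) (use assms in auto)
  then have "(\<Sum>x\<in>S. b * pmf p x) = b"
    by (simp flip: sum_distrib_left)
  then show ?thesis using assms
    by (simp add: expectation_eq_sum[of S] sum.distrib algebra_simps sum_distrib_left)
qed

lemma set_pmf_kernel_power:
  assumes "\<And>x. x \<in> S \<Longrightarrow> set_pmf (P x) \<subseteq> S" "x \<in> S"
  shows "set_pmf (kernel_power P t x) \<subseteq> S"
  using assms(2)
proof (induction t arbitrary: x)
  case (Suc t)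
  have "set_pmf (kernel_power P t y) \<subseteq> S" if "y \<in> set_pmf (P x)" for y
    using Suc.IH assms(1)[OF Suc.prems] that by blast
  then show ?case by auto
qed simp

lemma kernel_power_0_eq: "kernel_power P 0 = return_pmf"
  by (simp add: fun_eq_iff)

lemma kernel_power_Suc_eq:
  "kernel_power P (Suc t) = (\<lambda>x. bind_pmf (P x) (kernel_power P t))"
  by (simp add: fun_eq_iff)

lemma kernel_power_add:
  "kernel_power P (a + b) x = bind_pmf (kernel_power P a x) (kernel_power P b)"
proof (induction a arbitrary: x)
  case (Suc a)
  then have "kernel_power P (a + b) = (\<lambda>x. bind_pmf (kernel_power P a x) (kernel_power P b))"
    by (simp add: fun_eq_iff)
  then show ?case by (simp add: bind_assoc_pmf)
qed (simp add: bind_return_pmf)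

lemma stationary_kernel_power:
  assumes "bind_pmf \<mu> P = \<mu>"
  shows "bind_pmf \<mu> (kernel_power P t) = \<mu>"
proof (induction t)
  case (Suc t)
  have "bind_pmf \<mu> (kernel_power P (Suc t)) = bind_pmf (bind_pmf \<mu> P) (kernel_power P t)"
    by (simp add: kernel_power_Suc_eq bind_assoc_pmf)
  then show ?case by (simp only: assms Suc)
qed (simp add: bind_return_pmf' kernel_power_0_eq)

section \<open>Eigenfunctions and total variation distance\<close>

text \<open>Two distributions under which \<open>\<phi>\<close> has means \<open>M\<close> and \<open>0\<close> and variances at most \<open>V\<close> are far
  apart once \<open>M\<^sup>2\<close> dominates \<open>V\<close>. The mean difference is the integral of \<open>\<phi>\<close> against the signed
  density \<open>p - r\<close>; the Cauchy--Schwarz inequality with weight \<open>\<bar>p - r\<bar>\<close> bounds it by the total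
  variation distance times a second moment under \<open>p + r\<close>.\<close>

lemma tv_dist_second_moment:
  fixes \<phi> :: "'a \<Rightarrow> real"
  assumes S: "finite S" "set_pmf p \<subseteq> S" "set_pmf r \<subseteq> S"
    and p: "measure_pmf.expectation p \<phi> = M" "measure_pmf.expectation p (\<lambda>x. (\<phi> x)\<^sup>2) \<le> M\<^sup>2 + V"
    and r: "measure_pmf.expectation r \<phi> = 0" "measure_pmf.expectation r (\<lambda>x. (\<phi> x)\<^sup>2) \<le> V"
  shows "M\<^sup>2 \<le> tv_dist S p r * (4 * V + M\<^sup>2)"
proof -
  define w where "w x = \<bar>pmf p x - pmf r x\<bar>" for x
  \<comment> \<open>Centring at the midpoint of the two means minimises the second moment under \<open>p + r\<close>.\<close>
  define \<psi> where "\<psi> x = \<phi> x - M / 2" for x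
  have \<psi>: "(\<Sum>x\<in>S. pmf u x * \<psi> x) = measure_pmf.expectation u \<phi> - M / 2"
    if "set_pmf u \<subseteq> S" for u
    using expectation_affine[OF S(1) that, of 1 \<phi> "- M / 2"]
    by (simp add: \<psi>_def flip: expectation_eq_sum[OF S(1) that])
  have \<psi>2: "(\<Sum>x\<in>S. pmf u x * (\<psi> x)\<^sup>2)
      = measure_pmf.expectation u (\<lambda>x. (\<phi> x)\<^sup>2) - M * measure_pmf.expectation u \<phi> + M\<^sup>2 / 4"
    if u: "set_pmf u \<subseteq> S" for u
  proof -
    have "sum (pmf u) S = 1" by (rule sum_pmf_eq_1) (use S u in auto)
    then have "(\<Sum>x\<in>S. pmf u x * M\<^sup>2 / 4) = M\<^sup>2 / 4"
      by (simp flip: sum_distrib_right sum_divide_distrib)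
    moreover have "pmf u x * (\<psi> x)\<^sup>2
        = pmf u x * (\<phi> x)\<^sup>2 - M * (pmf u x * \<phi> x) + pmf u x * M\<^sup>2 / 4" for x
      by (simp add: \<psi>_def power2_eq_square field_simps)
    ultimately show ?thesis
      by (simp add: expectation_eq_sum[OF S(1) u] sum.distrib sum_subtractf sum_distrib_left)
  qed
  have "M = (\<Sum>x\<in>S. pmf p x * \<psi> x) - (\<Sum>x\<in>S. pmf r x * \<psi> x)"
    using \<psi>[OF S(2)] \<psi>[OF S(3)] p(1) r(1) by simp
  also have "\<dots> = (\<Sum>x\<in>S. (pmf p x - pmf r x) * \<psi> x)"
    by (simp add: sum_subtractf left_diff_distrib)
  finally have "\<bar>M\<bar> \<le> (\<Sum>x\<in>S. w x * \<bar>\<psi> x\<bar>)"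
    using sum_abs[of "\<lambda>x. (pmf p x - pmf r x) * \<psi> x" S] by (simp add: abs_mult w_def)
  then have "M\<^sup>2 \<le> (\<Sum>x\<in>S. w x * \<bar>\<psi> x\<bar>)\<^sup>2"
    by (metis abs_ge_zero power2_abs power_mono)
  also have "\<dots> = (\<Sum>x\<in>S. sqrt (w x) * (sqrt (w x) * \<bar>\<psi> x\<bar>))\<^sup>2"
    by (simp add: w_def flip: mult.assoc)
  also have "\<dots> \<le> (\<Sum>x\<in>S. (sqrt (w x))\<^sup>2) * (\<Sum>x\<in>S. (sqrt (w x) * \<bar>\<psi> x\<bar>)\<^sup>2)"
    by (rule Cauchy_Schwarz_ineq_sum)
  also have "\<dots> = (2 * tv_dist S p r) * (\<Sum>x\<in>S. w x * (\<psi> x)\<^sup>2)"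
    by (simp add: w_def tv_dist_def power_mult_distrib)
  also have "\<dots> \<le> (2 * tv_dist S p r) * (2 * V + M\<^sup>2 / 2)"
  proof (rule mult_left_mono)
    have "(\<Sum>x\<in>S. w x * (\<psi> x)\<^sup>2) \<le> (\<Sum>x\<in>S. pmf p x * (\<psi> x)\<^sup>2 + pmf r x * (\<psi> x)\<^sup>2)"
    proof (rule sum_mono)
      fix x
      have "w x \<le> pmf p x + pmf r x"
        using pmf_nonneg[of p x] pmf_nonneg[of r x] unfolding w_def by linarith
      from mult_right_mono[OF this, of "(\<psi> x)\<^sup>2"]
      show "w x * (\<psi> x)\<^sup>2 \<le> pmf p x * (\<psi> x)\<^sup>2 + pmf r x * (\<psi> x)\<^sup>2"
        by (simp add: algebra_simps)
    qed
    also have "\<dots> = measure_pmf.expectation p (\<lambda>x. (\<phi> x)\<^sup>2) - M * M + M\<^sup>2 / 4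
        + (measure_pmf.expectation r (\<lambda>x. (\<phi> x)\<^sup>2) + M\<^sup>2 / 4)"
      using p(1) r(1) by (simp add: sum.distrib \<psi>2[OF S(2)] \<psi>2[OF S(3)])
    also have "\<dots> \<le> 2 * V + M\<^sup>2 / 2"
      using p(2) r(2) unfolding power2_eq_square by linarith
    finally show "(\<Sum>x\<in>S. w x * (\<psi> x)\<^sup>2) \<le> 2 * V + M\<^sup>2 / 2" .
  qed (simp add: tv_dist_def sum_nonneg)
  finally show ?thesis by (simp add: algebra_simps)
qed

text \<open>If one step contracts the mean of \<open>\<phi>\<close> by \<open>m\<close> and creates variance at most \<open>V (1 - m\<^sup>2)\<close>,
  then the recursion \<open>v \<mapsto> m\<^sup>2 v + V (1 - m\<^sup>2)\<close> for the variance has fixed point \<open>V\<close>, so that the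
  variance never exceeds \<open>V\<close>.\<close>

lemma kernel_power_eigenfunction_moments:
  fixes \<phi> :: "'a \<Rightarrow> real"
  assumes S: "finite S" "\<And>x. x \<in> S \<Longrightarrow> set_pmf (P x) \<subseteq> S"
    and mean: "\<And>x. x \<in> S \<Longrightarrow> measure_pmf.expectation (P x) \<phi> = m * \<phi> x"
    and sq: "\<And>x. x \<in> S \<Longrightarrow> measure_pmf.expectation (P x) (\<lambda>x. (\<phi> x)\<^sup>2) \<le> m\<^sup>2 * (\<phi> x)\<^sup>2 + V * (1 - m\<^sup>2)"
    and x: "x \<in> S"
  shows "measure_pmf.expectation (kernel_power P t x) \<phi> = m ^ t * \<phi> x
       \<and> measure_pmf.expectation (kernel_power P t x) (\<lambda>x. (\<phi> x)\<^sup>2)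
         \<le> (m ^ t)\<^sup>2 * (\<phi> x)\<^sup>2 + V * (1 - (m ^ t)\<^sup>2)"
  using x
proof (induction t arbitrary: x)
  case 0
  then show ?case by simp
next
  case (Suc t)
  note Px = S(2)[OF Suc.prems]
  note kp = set_pmf_kernel_power[of S P, OF S(2)]
  have bind: "measure_pmf.expectation (kernel_power P (Suc t) x) g
      = measure_pmf.expectation (P x) (\<lambda>y. measure_pmf.expectation (kernel_power P t y) g)"
    for g :: "'a \<Rightarrow> real"
    using expectation_bind[OF S(1) Px, of "kernel_power P t" g] kp by simp
  have "measure_pmf.expectation (kernel_power P (Suc t) x) \<phi>
      = measure_pmf.expectation (P x) (\<lambda>y. m ^ t * \<phi> y + 0)"
    unfolding bind by (rule expectation_cong[OF S(1) Px]) (use Suc.IH in simp)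
  also have "\<dots> = m ^ Suc t * \<phi> x"
    using mean[OF Suc.prems] by (subst expectation_affine[OF S(1) Px]) simp
  finally have 1: "measure_pmf.expectation (kernel_power P (Suc t) x) \<phi> = m ^ Suc t * \<phi> x" .
  have "measure_pmf.expectation (kernel_power P (Suc t) x) (\<lambda>x. (\<phi> x)\<^sup>2)
      \<le> measure_pmf.expectation (P x) (\<lambda>y. (m ^ t)\<^sup>2 * (\<phi> y)\<^sup>2 + V * (1 - (m ^ t)\<^sup>2))"
    unfolding bind by (rule expectation_mono[OF S(1) Px]) (use Suc.IH in simp)
  also have "\<dots> = (m ^ t)\<^sup>2 * measure_pmf.expectation (P x) (\<lambda>x. (\<phi> x)\<^sup>2) + V * (1 - (m ^ t)\<^sup>2)"
    by (rule expectation_affine[OF S(1) Px])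
  also have "\<dots> \<le> (m ^ t)\<^sup>2 * (m\<^sup>2 * (\<phi> x)\<^sup>2 + V * (1 - m\<^sup>2)) + V * (1 - (m ^ t)\<^sup>2)"
    using mult_left_mono[OF sq[OF Suc.prems], of "(m ^ t)\<^sup>2"] by simp
  also have "\<dots> = (m ^ Suc t)\<^sup>2 * (\<phi> x)\<^sup>2 + V * (1 - (m ^ Suc t)\<^sup>2)"
    by (simp add: power_mult_distrib algebra_simps)
  finally show ?case using 1 by simp
qed

text \<open>Invariance of \<open>\<mu>\<close> turns the one-step identities into equations for the moments under \<open>\<mu>\<close>
  itself, so the stationary distribution need not be known explicitly.\<close>

lemma stationary_eigenfunction_moments:
  fixes \<phi> :: "'a \<Rightarrow> real"
  assumes S: "finite S" "\<And>x. x \<in> S \<Longrightarrow> set_pmf (P x) \<subseteq> S"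
    and mean: "\<And>x. x \<in> S \<Longrightarrow> measure_pmf.expectation (P x) \<phi> = m * \<phi> x"
    and sq: "\<And>x. x \<in> S \<Longrightarrow> measure_pmf.expectation (P x) (\<lambda>x. (\<phi> x)\<^sup>2) \<le> m\<^sup>2 * (\<phi> x)\<^sup>2 + V * (1 - m\<^sup>2)"
    and \<mu>: "set_pmf \<mu> \<subseteq> S" "bind_pmf \<mu> P = \<mu>" and m: "0 \<le> m" "m < 1"
  shows "measure_pmf.expectation \<mu> \<phi> = 0"
    and "measure_pmf.expectation \<mu> (\<lambda>x. (\<phi> x)\<^sup>2) \<le> V"
proof -
  have bind: "measure_pmf.expectation \<mu> g
      = measure_pmf.expectation \<mu> (\<lambda>y. measure_pmf.expectation (P y) g)" for g :: "'a \<Rightarrow> real"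
    using expectation_bind[OF S(1) \<mu>(1), of P g] S(2) \<mu>(2) by simp
  have "measure_pmf.expectation \<mu> \<phi> = measure_pmf.expectation \<mu> (\<lambda>y. m * \<phi> y + 0)"
    by (subst bind, rule expectation_cong[OF S(1) \<mu>(1)]) (use mean in simp)
  also have "\<dots> = m * measure_pmf.expectation \<mu> \<phi>"
    by (subst expectation_affine[OF S(1) \<mu>(1)]) simp
  finally show "measure_pmf.expectation \<mu> \<phi> = 0" using m by simp
  let ?E = "measure_pmf.expectation \<mu> (\<lambda>x. (\<phi> x)\<^sup>2)"
  have "?E \<le> measure_pmf.expectation \<mu> (\<lambda>y. m\<^sup>2 * (\<phi> y)\<^sup>2 + V * (1 - m\<^sup>2))"
    by (subst bind, rule expectation_mono[OF S(1) \<mu>(1)]) (use sq in simp)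
  also have "\<dots> = m\<^sup>2 * ?E + V * (1 - m\<^sup>2)"
    by (rule expectation_affine[OF S(1) \<mu>(1)])
  finally have "?E * (1 - m\<^sup>2) \<le> V * (1 - m\<^sup>2)" by (simp add: algebra_simps)
  moreover have "m\<^sup>2 < 1" using m by (simp add: power_less_one_iff)
  ultimately show "?E \<le> V" by simp
qed

text \<open>Wilson's method: the chain is not mixed while the mean of the eigenfunction exceeds two
  standard deviations.\<close>

lemma tv_dist_eigenfunction_gt_half:
  fixes \<phi> :: "'a \<Rightarrow> real"
  assumes S: "finite S" "\<And>x. x \<in> S \<Longrightarrow> set_pmf (P x) \<subseteq> S"
    and mean: "\<And>x. x \<in> S \<Longrightarrow> measure_pmf.expectation (P x) \<phi> = m * \<phi> x"
    and sq: "\<And>x. x \<in> S \<Longrightarrow> measure_pmf.expectation (P x) (\<lambda>x. (\<phi> x)\<^sup>2) \<le> m\<^sup>2 * (\<phi> x)\<^sup>2 + V * (1 - m\<^sup>2)"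
    and \<mu>: "set_pmf \<mu> \<subseteq> S" "bind_pmf \<mu> P = \<mu>" and m: "0 \<le> m" "m < 1"
    and x: "x \<in> S" and V: "0 \<le> V" and large: "(m ^ t * \<phi> x)\<^sup>2 > 4 * V"
  shows "tv_dist S (kernel_power P t x) \<mu> > 1 / 2"
proof -
  define M where "M = m ^ t * \<phi> x"
  let ?p = "kernel_power P t x"
  have p: "set_pmf ?p \<subseteq> S" by (rule set_pmf_kernel_power[OF S(2) x])
  note mom = kernel_power_eigenfunction_moments[OF S mean sq x, of t]
  have "V * (1 - (m ^ t)\<^sup>2) \<le> V" using V by (simp add: algebra_simps)
  then have "measure_pmf.expectation ?p (\<lambda>x. (\<phi> x)\<^sup>2) \<le> M\<^sup>2 + V"
    using mom unfolding M_def power_mult_distrib by linarith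
  then have "M\<^sup>2 \<le> tv_dist S ?p \<mu> * (4 * V + M\<^sup>2)"
    using mom stationary_eigenfunction_moments[OF S mean sq \<mu> m]
    by (intro tv_dist_second_moment[OF S(1) p \<mu>(1)]) (auto simp: M_def)
  moreover have "4 * V < M\<^sup>2" using large by (simp add: M_def)
  ultimately have "1 / 2 * (4 * V + M\<^sup>2) < tv_dist S ?p \<mu> * (4 * V + M\<^sup>2)" by argo
  moreover have "0 < 4 * V + M\<^sup>2" using V \<open>4 * V < M\<^sup>2\<close> by linarith
  ultimately show ?thesis by (simp only: mult_less_cancel_right_pos)
qed

section \<open>Convergence to the stationary distribution\<close>

text \<open>All rows of \<open>Q\<close> put mass at least \<open>\<delta>\<close> on a point \<open>z\<close> where \<open>u\<close> is minimal. Hence every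
  average of \<open>u\<close> lies between \<open>u z\<close> and \<open>u z + (1 - \<delta>) c\<close>.\<close>

lemma doeblin_contraction:
  fixes u :: "'a \<Rightarrow> real"
  assumes S: "finite S" "\<And>x. x \<in> S \<Longrightarrow> set_pmf (Q x) \<subseteq> S"
    and \<delta>: "\<And>x y. x \<in> S \<Longrightarrow> y \<in> S \<Longrightarrow> \<delta> \<le> pmf (Q x) y"
    and c: "\<And>x y. x \<in> S \<Longrightarrow> y \<in> S \<Longrightarrow> u x - u y \<le> c"
    and xy: "x \<in> S" "y \<in> S"
  shows "measure_pmf.expectation (Q x) u - measure_pmf.expectation (Q y) u \<le> (1 - \<delta>) * c"
proof -
  obtain z where z: "z \<in> S" "\<And>w. w \<in> S \<Longrightarrow> u z \<le> u w"
    using S(1) xy(1) by (metis arg_min_if_finite(1) arg_min_least empty_iff)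
  have c0: "0 \<le> c" using c[OF xy(1) xy(1)] by simp
  have "u z = measure_pmf.expectation (Q y) (\<lambda>_. u z)" by simp
  also have "\<dots> \<le> measure_pmf.expectation (Q y) u"
    by (rule expectation_mono[OF S(1) S(2)[OF xy(2)]]) (use z in simp)
  finally have lower: "u z \<le> measure_pmf.expectation (Q y) u" .
  have "measure_pmf.expectation (Q x) u
      \<le> measure_pmf.expectation (Q x) (\<lambda>w. (- c) * indicator {z} w + (u z + c))"
    by (rule expectation_mono[OF S(1) S(2)[OF xy(1)]]) (use c z in \<open>auto simp: indicator_def algebra_simps\<close>)
  also have "\<dots> = (- c) * pmf (Q x) z + (u z + c)"
    by (subst expectation_affine[OF S(1) S(2)[OF xy(1)]]) (simp add: pmf.rep_eq)
  also have "\<dots> \<le> u z + (1 - \<delta>) * c"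
    using mult_right_mono[OF \<delta>[OF xy(1) z(1)] c0] by (simp add: algebra_simps)
  finally show ?thesis using lower by simp
qed

text \<open>Laziness makes the support of \<open>P\<^sup>t(x, \<sqdot>)\<close> grow with \<open>t\<close>, so irreducibility on a finite set
  provides a single time \<open>T\<close> at which all entries of \<open>P\<^sup>T\<close> are positive, and the previous
  lemma applies to \<open>P\<^sup>T\<close>.\<close>

lemma tv_dist_eventually_small:
  assumes S: "finite S" "\<And>x. x \<in> S \<Longrightarrow> set_pmf (P x) \<subseteq> S"
    and lazy: "\<And>x. x \<in> S \<Longrightarrow> x \<in> set_pmf (P x)"
    and irr: "\<And>x y. x \<in> S \<Longrightarrow> y \<in> S \<Longrightarrow> (x, y) \<in> {(x, y). x \<in> S \<and> y \<in> set_pmf (P x)}\<^sup>*"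
    and \<mu>: "set_pmf \<mu> \<subseteq> S" "bind_pmf \<mu> P = \<mu>"
    and x: "x \<in> S" and \<epsilon>: "0 < \<epsilon>"
  shows "\<exists>t>0. tv_dist S (kernel_power P t x) \<mu> \<le> \<epsilon>"
proof -
  have step: "y \<in> set_pmf (kernel_power P (Suc t) x)" if "x \<in> S" "y \<in> set_pmf (kernel_power P t x)" for x y t
    using lazy[OF that(1)] that(2) by auto
  have mono: "y \<in> set_pmf (kernel_power P t' x)"
    if "x \<in> S" "y \<in> set_pmf (kernel_power P t x)" "t \<le> t'" for x y t t'
    using that(3) by (induction t' rule: dec_induct) (use that step in auto)
  have "\<exists>t. y \<in> set_pmf (kernel_power P t x)"
    if "(x, y) \<in> {(x, y). x \<in> S \<and> y \<in> set_pmf (P x)}\<^sup>*" for x y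
    using that
  proof (induction rule: converse_rtrancl_induct)
    case base
    show ?case by (rule exI[of _ 0]) simp
  next
    case (step a b)
    then obtain t where "y \<in> set_pmf (kernel_power P t b)" by blast
    then show ?case using step(1) by (intro exI[of _ "Suc t"]) auto
  qed
  then have "\<forall>p\<in>S \<times> S. \<exists>t. snd p \<in> set_pmf (kernel_power P t (fst p))" using irr by auto
  then obtain \<tau> where \<tau>: "\<forall>p\<in>S \<times> S. snd p \<in> set_pmf (kernel_power P (\<tau> p) (fst p))"
    by metis
  define T where "T = Suc (Max (\<tau> ` (S \<times> S)))"
  have pos: "y \<in> set_pmf (kernel_power P T x)" if "x \<in> S" "y \<in> S" for x y
  proof (rule mono[OF that(1)])
    show "y \<in> set_pmf (kernel_power P (\<tau> (x, y)) x)" using \<tau> that by auto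
    have "\<tau> (x, y) \<le> Max (\<tau> ` (S \<times> S))" using S(1) that by (intro Max_ge) auto
    then show "\<tau> (x, y) \<le> T" by (simp add: T_def)
  qed
  define Q where "Q = kernel_power P T"
  have Q: "set_pmf (Q x) \<subseteq> S" if "x \<in> S" for x
    unfolding Q_def using S(2) that by (rule set_pmf_kernel_power)
  define D where "D = (\<lambda>(x, y). pmf (Q x) y) ` (S \<times> S)"
  define \<delta> where "\<delta> = Min D"
  have D: "finite D" "D \<noteq> {}" using S(1) x by (auto simp: D_def)
  have "\<delta> \<in> D" unfolding \<delta>_def using D by (rule Min_in)
  then have \<delta>0: "0 < \<delta>" "\<delta> \<le> 1"
    using pos by (auto simp: D_def Q_def pmf_positive pmf_le_1)
  have \<delta>: "\<delta> \<le> pmf (Q x) y" if "x \<in> S" "y \<in> S" for x y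
    unfolding \<delta>_def using D(1) that by (intro Min_le) (auto simp: D_def)
  \<comment> \<open>Each column of \<open>P\<^bsup>kT\<^esup>\<close> becomes constant, and its \<open>\<mu>\<close>-average is \<open>\<mu> y\<close>.\<close>
  have osc: "pmf (kernel_power P (k * T) x) y - pmf (kernel_power P (k * T) x') y \<le> (1 - \<delta>) ^ k"
    if "x \<in> S" "x' \<in> S" for x x' y k
    using that
  proof (induction k arbitrary: x x')
    case 0
    show ?case by (simp add: indicator_def)
  next
    case (Suc k)
    have "pmf (kernel_power P (Suc k * T) z) y
        = measure_pmf.expectation (Q z) (\<lambda>w. pmf (kernel_power P (k * T) w) y)" for z
      by (simp add: kernel_power_add Q_def pmf_bind)
    then show ?case
      using doeblin_contraction[OF S(1) Q \<delta> Suc.IH Suc.prems] by simp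
  qed
  have close: "\<bar>pmf (kernel_power P (k * T) x) y - pmf \<mu> y\<bar> \<le> (1 - \<delta>) ^ k" for y k
  proof -
    let ?u = "\<lambda>w. pmf (kernel_power P (k * T) w) y"
    have "pmf \<mu> y = measure_pmf.expectation \<mu> ?u"
      by (metis pmf_bind stationary_kernel_power[OF \<mu>(2)])
    moreover have "measure_pmf.expectation \<mu> ?u \<le> measure_pmf.expectation \<mu> (\<lambda>_. ?u x + (1 - \<delta>) ^ k)"
      by (rule expectation_mono[OF S(1) \<mu>(1)]) (use osc[OF _ x, of _ k y] in \<open>simp add: diff_le_eq add.commute\<close>)
    moreover have "measure_pmf.expectation \<mu> (\<lambda>_. ?u x - (1 - \<delta>) ^ k) \<le> measure_pmf.expectation \<mu> ?u"
      by (rule expectation_mono[OF S(1) \<mu>(1)]) (use osc[OF x, of _ k y] in \<open>simp add: diff_le_eq add.commute\<close>)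
    ultimately show ?thesis by (simp add: abs_le_iff)
  qed
  have "(\<lambda>k. 1 / 2 * (real (card S) * (1 - \<delta>) ^ k)) \<longlonglongrightarrow> 1 / 2 * (real (card S) * 0)"
    using \<delta>0 by (intro tendsto_intros LIMSEQ_power_zero) auto
  then have "\<forall>\<^sub>F k in sequentially. 1 / 2 * (real (card S) * (1 - \<delta>) ^ k) < \<epsilon>"
    using \<epsilon> by (intro order_tendstoD) auto
  then obtain k where k: "1 / 2 * (real (card S) * (1 - \<delta>) ^ k) < \<epsilon>" "0 < k"
    using eventually_gt_at_top[of "0 :: nat"] by (metis (lifting) eventually_conj eventually_sequentially le_refl)
  have "tv_dist S (kernel_power P (k * T) x) \<mu> \<le> 1 / 2 * (\<Sum>y\<in>S. (1 - \<delta>) ^ k)"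
    unfolding tv_dist_def by (intro mult_left_mono sum_mono close) auto
  also have "\<dots> \<le> \<epsilon>" using k by simp
  finally show ?thesis using k(2) by (intro exI[of _ "k * T"]) (simp add: T_def)
qed

text \<open>The mixing time is a least element, so a lower bound needs the set of admissible
  times to be nonempty: if no time achieved distance \<open>\<epsilon>\<close>, the value would be unspecified.\<close>

lemma mix_ge:
  assumes "finite S" "x \<in> S" "\<exists>t>0. tv_dist S (kernel_power P t x) \<mu> \<le> \<epsilon>"
    and far: "\<And>t. real t < T \<Longrightarrow> tv_dist S (kernel_power P t x) \<mu> > \<epsilon>"
  shows "T \<le> real (mix S P \<mu> \<epsilon>)"
proof -
  have "tv_dist S (kernel_power P (mix_from S P \<mu> \<epsilon> x) x) \<mu> \<le> \<epsilon>"
    unfolding mix_from_def using LeastI_ex[OF assms(3)] by blast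
  then have "T \<le> real (mix_from S P \<mu> \<epsilon> x)" using far by (meson linorder_not_le)
  also have "mix_from S P \<mu> \<epsilon> x \<le> mix S P \<mu> \<epsilon>"
    unfolding mix_def using assms by (intro Max_ge) auto
  finally show ?thesis by simp
qed

section \<open>Metropolis updates of path colorings\<close>

lemma path_edges_iff:
  "{u, v} \<in> path_edges n \<longleftrightarrow> (v = Suc u \<and> 1 \<le> u \<and> u < n) \<or> (u = Suc v \<and> 1 \<le> v \<and> v < n)"
  by (auto simp: path_edges_def doubleton_eq_iff)

lemma proper_colorings_iff:
  "\<sigma> \<in> proper_colorings q n \<longleftrightarrow>
     \<sigma> \<in> {1..n} \<rightarrow>\<^sub>E {0..<q} \<and> (\<forall>i. 1 \<le> i \<longrightarrow> i < n \<longrightarrow> \<sigma> i \<noteq> \<sigma> (Suc i))"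
  unfolding proper_colorings_def path_edges_iff by (auto; metis)

lemma finite_proper_colorings: "finite (proper_colorings q n)"
proof (rule finite_subset)
  show "proper_colorings q n \<subseteq> {1..n} \<rightarrow>\<^sub>E {0..<q}" by (auto simp: proper_colorings_def)
qed (simp add: finite_PiE)

lemma proper_coloring_lt:
  "\<sigma> \<in> proper_colorings q n \<Longrightarrow> v \<in> {1..n} \<Longrightarrow> \<sigma> v < q"
  by (auto simp: proper_colorings_def)

lemma proper_coloring_upd:
  assumes "\<sigma> \<in> proper_colorings q n" "v \<in> {1..n}" "c < q"
    "\<And>u. {u, v} \<in> path_edges n \<Longrightarrow> \<sigma> u \<noteq> c"
  shows "\<sigma>(v := c) \<in> proper_colorings q n"
proof -
  have "\<sigma>(v := c) \<in> {1..n} \<rightarrow>\<^sub>E {0..<q}"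
    using assms(1-3) by (auto simp: proper_colorings_def PiE_iff extensional_def)
  moreover have "(\<sigma>(v := c)) i \<noteq> (\<sigma>(v := c)) (Suc i)" if "1 \<le> i" "i < n" for i
    using assms(1) assms(4)[of i] assms(4)[of "Suc i"] that
    by (auto simp: proper_colorings_iff path_edges_iff)
  ultimately show ?thesis by (simp add: proper_colorings_iff)
qed

lemma set_pmf_metropolis:
  assumes "0 < q"
  shows "set_pmf (metropolis q n v \<sigma>)
    = (\<lambda>c. if \<forall>u. {u, v} \<in> path_edges n \<longrightarrow> \<sigma> u \<noteq> c then \<sigma>(v := c) else \<sigma>) ` {0..<q}"
  unfolding metropolis_def using assms by (simp add: set_pmf_of_set)

lemma metropolis_closed:
  assumes "0 < q" "\<sigma> \<in> proper_colorings q n" "v \<in> {1..n}"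
  shows "set_pmf (metropolis q n v \<sigma>) \<subseteq> proper_colorings q n"
  unfolding set_pmf_metropolis[OF assms(1)]
  using assms(2) proper_coloring_upd[OF assms(2,3)] by auto

lemma metropolis_single_change:
  assumes "\<sigma> \<in> proper_colorings q n" "\<sigma>(v := c) \<in> proper_colorings q n" "v \<in> {1..n}"
  shows "\<sigma>(v := c) \<in> set_pmf (metropolis q n v \<sigma>)"
proof -
  have "(\<sigma>(v := c)) v < q" using assms(2,3) by (rule proper_coloring_lt)
  then have c: "c < q" by simp
  have "\<sigma> u \<noteq> c" if "{u, v} \<in> path_edges n" for u
  proof -
    have "(\<sigma>(v := c)) i \<noteq> (\<sigma>(v := c)) (Suc i)" if "1 \<le> i" "i < n" for i
      using assms(2) that by (simp add: proper_colorings_iff)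
    from this[of u] this[of v] show ?thesis using that by (auto simp: path_edges_iff)
  qed
  then show ?thesis using c by (subst set_pmf_metropolis) (auto intro!: image_eqI[of _ _ c])
qed

lemma metropolis_lazy:
  assumes "\<sigma> \<in> proper_colorings q n" "v \<in> {1..n}"
  shows "\<sigma> \<in> set_pmf (metropolis q n v \<sigma>)"
  using metropolis_single_change[of \<sigma> q n v "\<sigma> v"] assms unfolding fun_upd_triv by blast

text \<open>Induction over a sweep removes its last update, so the scan is considered for arbitrary
  lists of vertices.\<close>

definition partial_scan :: "nat \<Rightarrow> nat \<Rightarrow> nat list \<Rightarrow> (nat \<Rightarrow> nat) \<Rightarrow> (nat \<Rightarrow> nat) pmf" where
  "partial_scan q n vs \<sigma> = fold (\<lambda>v p. bind_pmf p (metropolis q n v)) vs (return_pmf \<sigma>)"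

lemma partial_scan_Nil: "partial_scan q n [] \<sigma> = return_pmf \<sigma>"
  by (simp add: partial_scan_def)

lemma partial_scan_snoc:
  "partial_scan q n (vs @ [v]) \<sigma> = bind_pmf (partial_scan q n vs \<sigma>) (metropolis q n v)"
  by (simp add: partial_scan_def)

lemma systematic_scan_eq: "systematic_scan q n = partial_scan q n [1..<n + 1]"
  by (simp add: fun_eq_iff systematic_scan_def partial_scan_def)

lemma partial_scan_closed:
  assumes "0 < q" "\<sigma> \<in> proper_colorings q n" "set vs \<subseteq> {1..n}"
  shows "set_pmf (partial_scan q n vs \<sigma>) \<subseteq> proper_colorings q n"
  using assms(3)
proof (induction vs rule: rev_induct)
  case (snoc v vs)
  then show ?case using metropolis_closed[OF assms(1)]
    by (simp add: partial_scan_snoc) blast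
qed (simp add: partial_scan_Nil assms)

lemma partial_scan_lazy:
  assumes "\<sigma> \<in> proper_colorings q n" "set vs \<subseteq> {1..n}"
  shows "\<sigma> \<in> set_pmf (partial_scan q n vs \<sigma>)"
  using assms(2)
proof (induction vs rule: rev_induct)
  case (snoc v vs)
  then show ?case using metropolis_lazy[OF assms(1)]
    by (auto simp add: partial_scan_snoc)
qed (simp add: partial_scan_Nil assms)

text \<open>Every update may leave the coloring unchanged, hence a whole sweep can realise any single
  recoloring.\<close>

lemma partial_scan_single_change:
  assumes "\<sigma> \<in> proper_colorings q n" "\<sigma>(v := c) \<in> proper_colorings q n"
    "set vs \<subseteq> {1..n}" "v \<in> set vs"
  shows "\<sigma>(v := c) \<in> set_pmf (partial_scan q n vs \<sigma>)"
  using assms(3,4)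
proof (induction vs rule: rev_induct)
  case (snoc w ws)
  have bindI: "\<tau> \<in> set_pmf (partial_scan q n (ws @ [w]) \<sigma>)"
    if "\<rho> \<in> set_pmf (partial_scan q n ws \<sigma>)" "\<tau> \<in> set_pmf (metropolis q n w \<rho>)" for \<rho> \<tau>
    using that by (auto simp: partial_scan_snoc)
  have w: "set ws \<subseteq> {1..n}" "w \<in> {1..n}" using snoc.prems by auto
  show ?case
  proof (cases "v = w")
    case True
    show ?thesis
      by (rule bindI[OF partial_scan_lazy[OF assms(1) w(1)]])
         (use metropolis_single_change[OF assms(1,2)] w True in blast)
  next
    case False
    then have "v \<in> set ws" using snoc.prems(2) by auto
    then show ?thesis
      by (rule bindI[OF snoc.IH[OF w(1)] metropolis_lazy[OF assms(2) w(2)]])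
  qed
qed simp

section \<open>Connectedness of the proper 3-colorings\<close>

definition scan_moves :: "nat \<Rightarrow> ((nat \<Rightarrow> nat) \<times> (nat \<Rightarrow> nat)) set" where
  "scan_moves n = {(\<sigma>, \<tau>). \<sigma> \<in> proper_colorings 3 n \<and> \<tau> \<in> set_pmf (systematic_scan 3 n \<sigma>)}"

text \<open>If the vertices on which two colorings differ are pairwise non-adjacent, they can be
  recolored one after the other: the neighbors of such a vertex already carry their final
  colors, so each intermediate coloring is proper.\<close>

lemma reach_if_differ_independent:
  assumes "\<sigma> \<in> proper_colorings 3 n" "\<tau> \<in> proper_colorings 3 n"
    and indep: "\<And>i. 1 \<le> i \<Longrightarrow> i < n \<Longrightarrow> \<sigma> i = \<tau> i \<or> \<sigma> (Suc i) = \<tau> (Suc i)"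
  shows "(\<sigma>, \<tau>) \<in> (scan_moves n)\<^sup>*"
  using assms
proof (induction "card {i \<in> {1..n}. \<sigma> i \<noteq> \<tau> i}" arbitrary: \<sigma>)
  case 0
  then have "{i \<in> {1..n}. \<sigma> i \<noteq> \<tau> i} = {}" by simp
  then have "\<forall>i\<in>{1..n}. \<sigma> i = \<tau> i" by blast
  moreover have "\<sigma> \<in> {1..n} \<rightarrow>\<^sub>E {0..<3}" "\<tau> \<in> {1..n} \<rightarrow>\<^sub>E {0..<3}"
    using 0 by (simp_all add: proper_colorings_iff)
  ultimately have "\<sigma> = \<tau>" by (meson PiE_ext)
  then show ?case by simp
next
  case (Suc k)
  let ?D = "\<lambda>\<sigma>. {i \<in> {1..n}. \<sigma> i \<noteq> \<tau> i}"
  have "?D \<sigma> \<noteq> {}" using Suc(2) by (metis card.empty nat.distinct(1))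
  then obtain v where v: "v \<in> {1..n}" "\<sigma> v \<noteq> \<tau> v" by blast
  let ?\<rho> = "\<sigma>(v := \<tau> v)"
  have \<rho>: "?\<rho> \<in> proper_colorings 3 n"
  proof (rule proper_coloring_upd[OF Suc.prems(1) v(1)])
    show "\<tau> v < 3" using Suc.prems(2) v(1) by (rule proper_coloring_lt)
    fix u assume "{u, v} \<in> path_edges n"
    then have e: "(v = Suc u \<and> 1 \<le> u \<and> u < n) \<or> (u = Suc v \<and> 1 \<le> v \<and> v < n)"
      by (simp only: path_edges_iff)
    then have "\<sigma> u = \<tau> u" using Suc.prems(3) v(2) by blast
    moreover have "\<tau> u \<noteq> \<tau> v" using Suc.prems(2) e by (auto simp: proper_colorings_iff)
    ultimately show "\<sigma> u \<noteq> \<tau> v" by simp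
  qed
  have "?D ?\<rho> = ?D \<sigma> - {v}" by auto
  then have "card (?D ?\<rho>) = card (?D \<sigma>) - 1" using v by (simp only:) (simp add: card_Diff_singleton)
  then have "k = card (?D ?\<rho>)" using Suc(2) by linarith
  moreover have "?\<rho> i = \<tau> i \<or> ?\<rho> (Suc i) = \<tau> (Suc i)" if "1 \<le> i" "i < n" for i
    using Suc.prems(3)[OF that] by auto
  ultimately have "(?\<rho>, \<tau>) \<in> (scan_moves n)\<^sup>*" using Suc(1) \<rho> Suc.prems(2) by blast
  moreover have "?\<rho> \<in> set_pmf (systematic_scan 3 n \<sigma>)"
    unfolding systematic_scan_eq
    by (rule partial_scan_single_change[OF Suc.prems(1) \<rho>]) (use v(1) in auto)
  then have "(\<sigma>, ?\<rho>) \<in> scan_moves n"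
    unfolding scan_moves_def using Suc.prems(1) by blast
  ultimately show ?case by (rule converse_rtrancl_into_rtrancl[rotated])
qed

definition reaches :: "nat \<Rightarrow> (nat \<Rightarrow> nat) \<Rightarrow> (nat \<Rightarrow> nat) \<Rightarrow> bool" where
  "reaches n \<sigma> \<tau> \<longleftrightarrow> (\<sigma>, \<tau>) \<in> (scan_moves n)\<^sup>* \<and> (\<tau>, \<sigma>) \<in> (scan_moves n)\<^sup>*"

lemma reaches_trans: "reaches n \<sigma> \<tau> \<Longrightarrow> reaches n \<tau> \<rho> \<Longrightarrow> reaches n \<sigma> \<rho>"
  by (auto simp: reaches_def)

lemma reaches_if_differ_independent:
  assumes "\<sigma> \<in> proper_colorings 3 n" "\<tau> \<in> proper_colorings 3 n"
    and "\<And>i. 1 \<le> i \<Longrightarrow> i < n \<Longrightarrow> \<sigma> i = \<tau> i \<or> \<sigma> (Suc i) = \<tau> (Suc i)"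
  shows "reaches n \<sigma> \<tau>"
  using reach_if_differ_independent[of \<sigma> n \<tau>] reach_if_differ_independent[of \<tau> n \<sigma>] assms
  unfolding reaches_def by metis

definition alternating :: "nat \<Rightarrow> nat \<Rightarrow> nat \<Rightarrow> nat \<Rightarrow> nat" where
  "alternating n a b = (\<lambda>i\<in>{1..n}. if even i then a else b)"

lemma alternating_proper:
  "a < 3 \<Longrightarrow> b < 3 \<Longrightarrow> a \<noteq> b \<Longrightarrow> alternating n a b \<in> proper_colorings 3 n"
  by (auto simp: alternating_def proper_colorings_iff)

lemma reaches_alternating_change:
  assumes "a < 3" "b < 3" "c < 3" "a \<noteq> b" "c \<noteq> b"
  shows "reaches n (alternating n a b) (alternating n c b)"
    and "reaches n (alternating n b a) (alternating n b c)"
proof -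
  show "reaches n (alternating n a b) (alternating n c b)"
  proof (rule reaches_if_differ_independent)
    show "alternating n a b \<in> proper_colorings 3 n" "alternating n c b \<in> proper_colorings 3 n"
      using assms by (intro alternating_proper; simp)+
  qed (auto simp: alternating_def)
  show "reaches n (alternating n b a) (alternating n b c)"
  proof (rule reaches_if_differ_independent)
    show "alternating n b a \<in> proper_colorings 3 n" "alternating n b c \<in> proper_colorings 3 n"
      using assms by (intro alternating_proper; simp)+
  qed (auto simp: alternating_def)
qed

text \<open>Only one of the two color classes is changed at a time. If \<open>b = 0\<close>, the class of \<open>b\<close> has to
  take the third color \<open>3 - a\<close> before the class of \<open>a\<close> can take the color \<open>0\<close>.\<close>

lemma reaches_alternating_01:
  assumes "a < 3" "b < 3" "a \<noteq> b"
  shows "reaches n (alternating n a b) (alternating n 0 1)"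
proof -
  have nz: "reaches n (alternating n a b) (alternating n 0 1)"
    if "a < 3" "b < 3" "a \<noteq> b" "b \<noteq> 0" for a b
    using reaches_trans[OF reaches_alternating_change(1)[of a b 0] reaches_alternating_change(2)[of b 0 1]]
      that by simp
  show ?thesis
  proof (cases "b = 0")
    case True
    have "3 - a \<noteq> a" by presburger
    then have "reaches n (alternating n a b) (alternating n a (3 - a))"
      using assms True by (intro reaches_alternating_change(2)) auto
    moreover have "reaches n (alternating n a (3 - a)) (alternating n 0 1)"
      using assms True by (intro nz; presburger)
    ultimately show ?thesis by (rule reaches_trans)
  qed (use nz assms in blast)
qed

text \<open>Induction on \<open>k\<close> makes the first \<open>k\<close> vertices alternate between the colors of \<open>k\<close> and
  \<open>k - 1\<close>. To extend the alternating part to vertex \<open>k + 1\<close>, all vertices of the prefix that do not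
  have the color of \<open>k\<close> are given the color of \<open>k + 1\<close>; these vertices are pairwise non-adjacent.\<close>

lemma reaches_alternating:
  assumes \<sigma>: "\<sigma> \<in> proper_colorings 3 n" and n: "2 \<le> n"
  shows "reaches n \<sigma> (alternating n 0 1)"
proof -
  define \<tau> where "\<tau> k = (\<lambda>i\<in>{1..n}. if k \<le> i then \<sigma> i else if even (k - i) then \<sigma> k else \<sigma> (k - 1))" for k
  have lt: "\<sigma> i < 3" if "1 \<le> i" "i \<le> n" for i
    using proper_coloring_lt[OF \<sigma>] that by simp
  have ne: "\<sigma> i \<noteq> \<sigma> (Suc i)" if "1 \<le> i" "i < n" for i
    using \<sigma> that by (auto simp: proper_colorings_iff)
  have proper: "\<tau> k \<in> proper_colorings 3 n" if k: "2 \<le> k" "k \<le> n" for k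
    unfolding proper_colorings_iff
  proof (intro conjI allI impI)
    show "\<tau> k \<in> {1..n} \<rightarrow>\<^sub>E {0..<3}" using k lt by (auto simp: \<tau>_def)
    have kk: "\<sigma> (k - 1) \<noteq> \<sigma> k" using ne[of "k - 1"] k by simp
    fix i assume i: "1 \<le> i" "i < n"
    consider "k \<le> i" | "Suc i = k" | "Suc i < k" by linarith
    then show "\<tau> k i \<noteq> \<tau> k (Suc i)"
    proof cases
      case 1 then show ?thesis using i ne by (simp add: \<tau>_def)
    next
      case 2 then show ?thesis using i k kk by (auto simp add: \<tau>_def)
    next
      case 3
      then have "k - i = Suc (k - Suc i)" by simp
      then show ?thesis using 3 i k kk by (auto simp add: \<tau>_def)
    qed
  qed
  have "reaches n \<sigma> (\<tau> k)" if "2 \<le> k" "k \<le> n" for k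
    using that
  proof (induction k rule: dec_induct)
    case base
    have "\<tau> 2 = \<sigma>"
    proof
      fix i
      show "\<tau> 2 i = \<sigma> i"
      proof (cases "i \<in> {1..n}")
        case True
        then consider "i = 1" | "2 \<le> i" by fastforce
        then show ?thesis using True by cases (auto simp: \<tau>_def)
      next
        case False
        then show ?thesis using \<sigma> by (auto simp: \<tau>_def proper_colorings_def PiE_iff extensional_def)
      qed
    qed
    then show ?case by (simp add: reaches_def)
  next
    case (step k)
    have "reaches n (\<tau> k) (\<tau> (Suc k))"
    proof (rule reaches_if_differ_independent)
      fix i assume i: "1 \<le> i" "i < n"
      have same: "\<tau> k j = \<tau> (Suc k) j" if "1 \<le> j" "j \<le> n" "k \<le> j \<or> even (k - j)" for j
      proof -
        have "j = k \<or> Suc k \<le> j \<or> j < k \<and> even (k - j)" using that(3) by auto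
        then consider "j = k" | "Suc k \<le> j" | "j < k" "even (k - j)" by blast
        then show ?thesis by cases (use that(1,2) in \<open>auto simp: \<tau>_def Suc_diff_le\<close>)
      qed
      consider "k \<le> i" | "Suc i \<le> k" by linarith
      then show "\<tau> k i = \<tau> (Suc k) i \<or> \<tau> k (Suc i) = \<tau> (Suc k) (Suc i)"
      proof cases
        case 1 then show ?thesis using same[of i] i by simp
      next
        case 2
        then have "k - i = Suc (k - Suc i)" by simp
        then have "even (k - i) \<or> even (k - Suc i)" by (metis even_Suc)
        then show ?thesis using same[of i] same[of "Suc i"] i by auto
      qed
    qed (use proper step in auto)
    moreover have "reaches n \<sigma> (\<tau> k)" using step by simp
    ultimately show ?case using reaches_trans by blast
  qed
  from this[OF n order_refl] have "reaches n \<sigma> (\<tau> n)" .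
  moreover have "reaches n (\<tau> n) (alternating n 0 1)"
  proof -
    have last: "\<sigma> (n - 1) \<noteq> \<sigma> n" "\<sigma> n < 3" "\<sigma> (n - 1) < 3"
      using ne[of "n - 1"] lt n by auto
    obtain a b where ab: "a < 3" "b < 3" "a \<noteq> b" "\<tau> n = alternating n a b"
    proof (cases "even n")
      case True
      show ?thesis
        by (rule that[of "\<sigma> n" "\<sigma> (n - 1)"])
           (use n last True in \<open>auto simp: \<tau>_def alternating_def fun_eq_iff restrict_def\<close>)
    next
      case False
      show ?thesis
        by (rule that[of "\<sigma> (n - 1)" "\<sigma> n"])
           (use n last False in \<open>auto simp: \<tau>_def alternating_def fun_eq_iff restrict_def\<close>)
    qed
    show ?thesis using reaches_alternating_01[OF ab(1-3)] ab(4) by simp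
  qed
  ultimately show ?thesis by (rule reaches_trans)
qed

lemma scan_irreducible:
  assumes "\<sigma> \<in> proper_colorings 3 n" "\<tau> \<in> proper_colorings 3 n" "2 \<le> n"
  shows "(\<sigma>, \<tau>) \<in> (scan_moves n)\<^sup>*"
  using reaches_alternating[OF assms(1,3)] reaches_alternating[OF assms(2,3)]
  by (auto simp: reaches_def)

text \<open>If all neighbors of \<open>v\<close> have the same color \<open>b\<close>, then \<open>v\<close> may take exactly two colors, its
  own color \<open>a\<close> and \<open>3 - a - b\<close>. If its two neighbors have different colors, its color is forced.\<close>

definition flip :: "nat \<Rightarrow> nat \<Rightarrow> (nat \<Rightarrow> nat) \<Rightarrow> nat \<Rightarrow> nat" where
  "flip n v \<sigma> = (if 1 < v \<and> v < n \<and> \<sigma> (v - 1) \<noteq> \<sigma> (v + 1) then \<sigma>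
     else \<sigma>(v := 3 - \<sigma> v - \<sigma> (if v = 1 then 2 else v - 1)))"

section \<open>Updates as lazy flips\<close>

lemma some_neighbor:
  assumes "v \<in> {1..n}" "2 \<le> n"
  defines "w \<equiv> if v = 1 then 2 else v - 1"
  shows "{w, v} \<in> path_edges n" "w \<in> {1..n}" "w \<noteq> v"
  unfolding path_edges_iff w_def using assms(1,2) by auto

lemma proper_coloring_adjacent:
  "\<sigma> \<in> proper_colorings q n \<Longrightarrow> {u, v} \<in> path_edges n \<Longrightarrow> \<sigma> u \<noteq> \<sigma> v"
  by (auto simp: proper_colorings_def)

lemma color_unique:
  assumes "a < 3" "b < 3" "c < 3" "d < (3::nat)" "a \<noteq> b" "a \<noteq> c" "b \<noteq> c" "d \<noteq> b" "d \<noteq> c"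
  shows "d = a"
  using assms by linarith

lemma sum_over_colors:
  fixes F :: "nat \<Rightarrow> real"
  assumes "a < 3" "b < 3" "a \<noteq> b"
  shows "(\<Sum>c\<in>{0, 1, 2}. F c) = F b + F a + F (3 - a - b)"
proof -
  have "a = 0 \<or> a = 1 \<or> a = 2" "b = 0 \<or> b = 1 \<or> b = 2" using assms by linarith+
  then show ?thesis using assms(3) by (elim disjE) simp_all
qed

text \<open>A Metropolis update on a path with three colors is therefore a lazy flip: of the three
  proposals one flips \<open>v\<close> (when it can be flipped), and the other two have no effect.\<close>

lemma expectation_metropolis:
  fixes \<phi> :: "(nat \<Rightarrow> nat) \<Rightarrow> real"
  assumes \<sigma>: "\<sigma> \<in> proper_colorings 3 n" and v: "v \<in> {1..n}" and n: "2 \<le> n"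
  shows "measure_pmf.expectation (metropolis 3 n v \<sigma>) \<phi> = (2 * \<phi> \<sigma> + \<phi> (flip n v \<sigma>)) / 3"
proof -
  define C where "C c \<longleftrightarrow> (\<forall>u. {u, v} \<in> path_edges n \<longrightarrow> \<sigma> u \<noteq> c)" for c
  have E: "measure_pmf.expectation (metropolis 3 n v \<sigma>) \<phi>
      = (\<Sum>c\<in>{0, 1, 2}. \<phi> (if C c then \<sigma>(v := c) else \<sigma>)) / 3"
  proof -
    have "{0..<3::nat} = {0, 1, 2}" by auto
    then show ?thesis by (simp add: metropolis_def C_def integral_pmf_of_set)
  qed
  define b where "b = \<sigma> (if v = 1 then 2 else v - 1)"
  have vb: "\<sigma> v < 3" "b < 3" "\<sigma> v \<noteq> b"
    using proper_coloring_lt[OF \<sigma>] v some_neighbor[OF v n] proper_coloring_adjacent[OF \<sigma>]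
    unfolding b_def by metis+
  show ?thesis
  proof (cases "1 < v \<and> v < n \<and> \<sigma> (v - 1) \<noteq> \<sigma> (v + 1)")
    case True
    have C: "C c \<longleftrightarrow> c \<noteq> \<sigma> (v - 1) \<and> c \<noteq> \<sigma> (v + 1)" for c
    proof -
      have "{u, v} \<in> path_edges n \<longleftrightarrow> u = v - 1 \<or> u = v + 1" for u
        unfolding path_edges_iff using True by auto
      then show ?thesis unfolding C_def by metis
    qed
    have "\<sigma> (v - 1) < 3" "\<sigma> (v + 1) < 3" "\<sigma> v \<noteq> \<sigma> (v - 1)" "\<sigma> v \<noteq> \<sigma> (v + 1)"
    proof -
      have "{v - 1, v} \<in> path_edges n" "{v + 1, v} \<in> path_edges n" "v - 1 \<in> {1..n}" "v + 1 \<in> {1..n}"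
        using True by (auto simp: path_edges_iff)
      then show "\<sigma> (v - 1) < 3" "\<sigma> (v + 1) < 3" "\<sigma> v \<noteq> \<sigma> (v - 1)" "\<sigma> v \<noteq> \<sigma> (v + 1)"
        using proper_coloring_lt[OF \<sigma>] proper_coloring_adjacent[OF \<sigma>] by metis+
    qed
    then have "c = \<sigma> v" if "C c" "c < 3" for c
      using color_unique[of "\<sigma> v" "\<sigma> (v - 1)" "\<sigma> (v + 1)" c] True vb(1) that by (simp add: C)
    then have same: "(if C c then \<sigma>(v := c) else \<sigma>) = \<sigma>" if "c < 3" for c
      using that by (metis fun_upd_triv)
    have "\<phi> (if C c then \<sigma>(v := c) else \<sigma>) = \<phi> \<sigma>" if "c \<in> {0, 1, 2}" for c
    proof -
      have "c < 3" using that by auto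
      then show ?thesis by (simp only: same)
    qed
    then have "(\<Sum>c\<in>{0, 1, 2}. \<phi> (if C c then \<sigma>(v := c) else \<sigma>)) = (\<Sum>c\<in>{0, 1, 2::nat}. \<phi> \<sigma>)"
      by (intro sum.cong refl)
    moreover have "flip n v \<sigma> = \<sigma>" using True by (simp add: flip_def)
    ultimately show ?thesis unfolding E by simp
  next
    case False
    have "C c \<longleftrightarrow> c \<noteq> b" for c
    proof -
      have "{u, v} \<in> path_edges n \<Longrightarrow> \<sigma> u = b" for u
        unfolding path_edges_iff b_def using False by (auto simp: numeral_2_eq_2)
      moreover have "\<exists>u. {u, v} \<in> path_edges n \<and> \<sigma> u = b"
        unfolding path_edges_iff b_def using v n
        by (intro exI[of _ "if v = 1 then 2 else v - 1"]) auto
      ultimately show ?thesis unfolding C_def by metis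
    qed
    moreover have "flip n v \<sigma> = \<sigma>(v := 3 - \<sigma> v - b)"
      using False unfolding flip_def b_def by (rule if_not_P)
    moreover have "3 - \<sigma> v - b \<noteq> b" using vb by presburger
    ultimately show ?thesis
      unfolding E sum_over_colors[OF vb] using vb(3) by simp
  qed
qed

lemma flip_proper:
  assumes \<sigma>: "\<sigma> \<in> proper_colorings 3 n" and v: "v \<in> {1..n}" and n: "2 \<le> n"
  shows "flip n v \<sigma> \<in> proper_colorings 3 n"
proof -
  have "pmf (metropolis 3 n v \<sigma>) (flip n v \<sigma>)
      = measure_pmf.expectation (metropolis 3 n v \<sigma>) (indicator {flip n v \<sigma>})"
    by (simp add: pmf.rep_eq)
  also have "\<dots> > 0" unfolding expectation_metropolis[OF assms] by (simp add: indicator_def)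
  finally show ?thesis
    using metropolis_closed[OF _ \<sigma> v] by (auto simp: set_pmf_iff)
qed

lemma flip_involution:
  assumes \<sigma>: "\<sigma> \<in> proper_colorings 3 n" and v: "v \<in> {1..n}" and n: "2 \<le> n"
  shows "flip n v (flip n v \<sigma>) = \<sigma>"
proof -
  define w where "w = (if v = 1 then 2 else v - 1)"
  have w: "w \<noteq> v" using v by (auto simp: w_def)
  have "\<sigma> w + \<sigma> v \<le> 3"
  proof -
    have "\<sigma> w \<noteq> \<sigma> v" "\<sigma> w < 3" "\<sigma> v < 3"
      using proper_coloring_lt[OF \<sigma>] v some_neighbor[OF v n] proper_coloring_adjacent[OF \<sigma>]
      unfolding w_def by metis+
    then show ?thesis by linarith
  qed
  then have undo: "\<sigma>(v := 3 - (3 - \<sigma> v - \<sigma> w) - \<sigma> w) = \<sigma>" by (simp add: fun_upd_idem)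
  show ?thesis
  proof (cases "1 < v \<and> v < n \<and> \<sigma> (v - 1) \<noteq> \<sigma> (v + 1)")
    case True
    then show ?thesis by (simp add: flip_def)
  next
    case False
    define \<tau> where "\<tau> = \<sigma>(v := 3 - \<sigma> v - \<sigma> w)"
    have "flip n v \<sigma> = \<tau>" using False unfolding flip_def \<tau>_def w_def by (rule if_not_P)
    moreover have "\<not> (1 < v \<and> v < n \<and> \<tau> (v - 1) \<noteq> \<tau> (v + 1))"
      using False by (auto simp: \<tau>_def)
    then have "flip n v \<tau> = \<tau>(v := 3 - \<tau> v - \<tau> w)" unfolding flip_def w_def by (rule if_not_P)
    moreover have "\<tau>(v := 3 - \<tau> v - \<tau> w) = \<sigma>" using w undo by (simp add: \<tau>_def)
    ultimately show ?thesis by simp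
  qed
qed

lemma flip_bij:
  assumes "v \<in> {1..n}" "2 \<le> n"
  shows "bij_betw (flip n v) (proper_colorings 3 n) (proper_colorings 3 n)"
  using flip_proper flip_involution assms
  by (intro bij_betw_byWitness[of _ "flip n v"]) auto

text \<open>A flip permutes the proper colorings.\<close>

lemma uniform_stationary_metropolis:
  assumes v: "v \<in> {1..n}" and n: "2 \<le> n" and ne: "proper_colorings 3 n \<noteq> {}"
  shows "bind_pmf (pmf_of_set (proper_colorings 3 n)) (metropolis 3 n v)
       = pmf_of_set (proper_colorings 3 n)"
proof (rule pmf_eqI)
  fix \<tau>
  let ?S = "proper_colorings 3 n"
  note fin = finite_proper_colorings[of 3 n]
  have "(\<Sum>\<sigma>\<in>?S. pmf (metropolis 3 n v \<sigma>) \<tau>)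
      = (\<Sum>\<sigma>\<in>?S. (2 * indicator {\<tau>} \<sigma> + indicator {\<tau>} (flip n v \<sigma>)) / 3)"
    using v n by (intro sum.cong refl) (simp add: pmf.rep_eq flip: expectation_metropolis)
  also have "\<dots> = (2 * (\<Sum>\<sigma>\<in>?S. indicator {\<tau>} \<sigma>) + (\<Sum>\<sigma>\<in>?S. indicator {\<tau>} (flip n v \<sigma>))) / 3"
    by (simp add: sum.distrib sum_distrib_left flip: sum_divide_distrib)
  also have "\<dots> = (\<Sum>\<sigma>\<in>?S. indicator {\<tau>} \<sigma> :: real)"
    using sum.reindex_bij_betw[OF flip_bij[OF v n], of "indicator {\<tau>} :: _ \<Rightarrow> real"] by simp
  also have "\<dots> = indicator ?S \<tau>"
    using fin by (auto simp: indicator_def of_bool_def sum.delta')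
  finally show "pmf (bind_pmf (pmf_of_set ?S) (metropolis 3 n v)) \<tau> = pmf (pmf_of_set ?S) \<tau>"
    using fin ne by (simp add: pmf_bind integral_pmf_of_set)
qed

lemma uniform_stationary_scan:
  assumes n: "2 \<le> n" and ne: "proper_colorings 3 n \<noteq> {}"
  shows "bind_pmf (pmf_of_set (proper_colorings 3 n)) (systematic_scan 3 n)
       = pmf_of_set (proper_colorings 3 n)"
proof -
  let ?\<mu> = "pmf_of_set (proper_colorings 3 n)"
  have "bind_pmf ?\<mu> (partial_scan 3 n vs) = ?\<mu>" if "set vs \<subseteq> {1..n}" for vs
    using that
  proof (induction vs rule: rev_induct)
    case Nil
    have "partial_scan 3 n [] = return_pmf" by (simp add: fun_eq_iff partial_scan_Nil)
    then show ?case by (simp add: bind_return_pmf')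
  next
    case (snoc v vs)
    have "partial_scan 3 n (vs @ [v]) = (\<lambda>\<sigma>. bind_pmf (partial_scan 3 n vs \<sigma>) (metropolis 3 n v))"
      by (simp add: fun_eq_iff partial_scan_snoc)
    then have "bind_pmf ?\<mu> (partial_scan 3 n (vs @ [v]))
        = bind_pmf (bind_pmf ?\<mu> (partial_scan 3 n vs)) (metropolis 3 n v)"
      by (simp only: bind_assoc_pmf)
    then show ?case using snoc uniform_stationary_metropolis[OF _ n ne, of v] by simp
  qed
  moreover have "set [1..<n + 1] \<subseteq> {1..n}" by auto
  ultimately show ?thesis unfolding systematic_scan_eq by blast
qed

section \<open>Linear functionals of the height increments\<close>

text \<open>The step from color \<open>\<sigma> i\<close> to color \<open>\<sigma> (i + 1)\<close> is \<open>\<plusminus>1\<close> modulo \<open>3\<close>. These signs are the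
  increments of the height function of the coloring.\<close>

definition ascent :: "(nat \<Rightarrow> nat) \<Rightarrow> nat \<Rightarrow> real" where
  "ascent \<sigma> i = (if \<sigma> (Suc i) = (\<sigma> i + 1) mod 3 then 1 else - 1)"

definition weighted_height :: "nat \<Rightarrow> (nat \<Rightarrow> real) \<Rightarrow> (nat \<Rightarrow> nat) \<Rightarrow> real" where
  "weighted_height n f \<sigma> = (\<Sum>i\<in>{1..<n}. f i * ascent \<sigma> i)"

text \<open>The transpose of a flip acting on the signs: a flip at an interior vertex exchanges the
  two adjacent signs, a flip at an end of the path changes the sign next to it.\<close>

definition refl_weight :: "nat \<Rightarrow> nat \<Rightarrow> (nat \<Rightarrow> real) \<Rightarrow> nat \<Rightarrow> real" where
  "refl_weight n v f = (if v = 1 then f(1 := - f 1)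
     else if v = n then f(n - 1 := - f (n - 1))
     else f \<circ> Transposition.transpose (v - 1) v)"

definition avg_weight :: "nat \<Rightarrow> nat \<Rightarrow> (nat \<Rightarrow> real) \<Rightarrow> nat \<Rightarrow> real" where
  "avg_weight n v f = (\<lambda>i. (2 * f i + refl_weight n v f i) / 3)"

text \<open>Under the uniform distribution the signs are independent and symmetric, so this is the
  stationary variance of \<^term>\<open>weighted_height n f\<close>.\<close>

definition energy :: "nat \<Rightarrow> (nat \<Rightarrow> real) \<Rightarrow> real" where
  "energy n f = (\<Sum>i\<in>{1..<n}. (f i)\<^sup>2)"

lemma ascent_complement:
  assumes "a < 3" "b < 3" "a \<noteq> b"
  shows "b = (a + 1) mod 3 \<longleftrightarrow> a \<noteq> (b + 1) mod (3::nat)"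
    and "b = (3 - a - b + 1) mod 3 \<longleftrightarrow> b \<noteq> (a + 1) mod (3::nat)"
    and "3 - a - b = (b + 1) mod 3 \<longleftrightarrow> a \<noteq> (b + 1) mod (3::nat)"
proof -
  have "a = 0 \<or> a = 1 \<or> a = 2" "b = 0 \<or> b = 1 \<or> b = 2" using assms by linarith+
  then show "b = (a + 1) mod 3 \<longleftrightarrow> a \<noteq> (b + 1) mod (3::nat)"
    and "b = (3 - a - b + 1) mod 3 \<longleftrightarrow> b \<noteq> (a + 1) mod (3::nat)"
    and "3 - a - b = (b + 1) mod 3 \<longleftrightarrow> a \<noteq> (b + 1) mod (3::nat)"
    using assms(3) by (elim disjE; simp)+
qed

lemma color_step:
  assumes "a < 3" "b < 3" "c < 3" "a \<noteq> b" "b \<noteq> c" "a \<noteq> c"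
  shows "b = (a + 1) mod 3 \<longleftrightarrow> c = (b + 1) mod (3::nat)"
proof -
  have "a = 0 \<or> a = 1 \<or> a = 2" "b = 0 \<or> b = 1 \<or> b = 2" "c = 0 \<or> c = 1 \<or> c = 2"
    using assms by linarith+
  then show ?thesis using assms(4-6) by (elim disjE; simp)
qed

text \<open>At an interior vertex whose neighbors differ in color the coloring does not change, but
  then the two adjacent signs coincide, so that exchanging them has no effect either. This is what
  makes the evolution of the mean signs linear.\<close>

lemma ascent_flip:
  assumes \<sigma>: "\<sigma> \<in> proper_colorings 3 n" and v: "v \<in> {1..n}" and n: "2 \<le> n" and i: "i \<in> {1..<n}"
  shows "ascent (flip n v \<sigma>) i = (if v = 1 \<and> i = 1 \<or> v \<noteq> 1 \<and> v = n \<and> i = n - 1 then - ascent \<sigma> i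
     else if 1 < v \<and> v < n then ascent \<sigma> (Transposition.transpose (v - 1) v i) else ascent \<sigma> i)"
proof -
  have lt: "\<sigma> j < 3" if "1 \<le> j" "j \<le> n" for j
    using proper_coloring_lt[OF \<sigma>] that by simp
  have ne: "\<sigma> j \<noteq> \<sigma> (Suc j)" if "1 \<le> j" "j < n" for j
    using \<sigma> that by (auto simp: proper_colorings_iff)
  consider "v = 1" | "v \<noteq> 1" "v = n" | "1 < v" "v < n" using v by force
  then show ?thesis
  proof cases
    case 1
    have lt12: "\<sigma> 1 < 3" "\<sigma> (Suc 1) < 3" "\<sigma> 1 \<noteq> \<sigma> (Suc 1)"
      using lt[of 1] lt[of "Suc 1"] ne[of 1] n by simp_all
    have f: "flip n v \<sigma> = \<sigma>(1 := 3 - \<sigma> 1 - \<sigma> (Suc 1))"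
      using 1 by (simp add: flip_def numeral_2_eq_2)
    show ?thesis
      unfolding f using 1 i ascent_complement[OF lt12] by (auto simp: ascent_def)
  next
    case 2
    define m where "m = n - 1"
    have m: "n = Suc m" "1 \<le> m" using n by (auto simp: m_def)
    have ltm: "\<sigma> m < 3" "\<sigma> (Suc m) < 3" "\<sigma> m \<noteq> \<sigma> (Suc m)"
      using lt[of m] lt[of "Suc m"] ne[of m] m by simp_all
    have f: "flip n v \<sigma> = \<sigma>(Suc m := 3 - \<sigma> (Suc m) - \<sigma> m)"
      using 2 m by (simp add: flip_def)
    show ?thesis
      unfolding f using 2 i m ascent_complement[OF ltm] ascent_complement[OF ltm(2,1) ltm(3)[symmetric]]
      by (auto simp: ascent_def)
  next
    case 3
    define m where "m = v - 1"
    have m: "v = Suc m" "1 \<le> m" using 3 by (auto simp: m_def)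
    have s: "\<sigma> m < 3" "\<sigma> v < 3" "\<sigma> (Suc v) < 3" "\<sigma> m \<noteq> \<sigma> v" "\<sigma> v \<noteq> \<sigma> (Suc v)"
      using lt[of m] lt[of v] lt[of "Suc v"] ne[of m] ne[of v] m 3 by auto
    consider "i = m" | "i = v" | "i \<noteq> m" "i \<noteq> v" by blast
    note sites = this
    show ?thesis
    proof (cases "\<sigma> m = \<sigma> (Suc v)")
      case True
      then have f: "flip n v \<sigma> = \<sigma>(v := 3 - \<sigma> v - \<sigma> m)" using m by (simp add: flip_def)
      note c = ascent_complement[OF s(2,1) s(4)[symmetric]] ascent_complement[OF s(1,2,4)]
      have swap: "ascent (flip n v \<sigma>) m = ascent \<sigma> v" "ascent (flip n v \<sigma>) v = ascent \<sigma> m"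
        unfolding f ascent_def using c m True by (simp_all add: add.commute)
      have other: "ascent (flip n v \<sigma>) i = ascent \<sigma> i" if "i \<noteq> m" "i \<noteq> v"
        unfolding f ascent_def using that m by simp
      show ?thesis by (cases rule: sites) (use 3 m swap other in simp_all)
    next
      case False
      then have f: "flip n v \<sigma> = \<sigma>" using m 3 by (simp add: flip_def)
      have eq: "ascent \<sigma> m = ascent \<sigma> v"
        unfolding ascent_def m(1)[symmetric]
        using color_step[OF s(1-3) s(4,5) False] by simp
      show ?thesis unfolding f by (cases rule: sites) (use 3 m eq in simp_all)
    qed
  qed
qed

lemma transpose_permutes_sites:
  "1 < v \<Longrightarrow> v < n \<Longrightarrow> Transposition.transpose (v - 1) v permutes {1..<n :: nat}"
  by (rule permutes_swap_id) auto

lemma weighted_height_flip: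
  assumes \<sigma>: "\<sigma> \<in> proper_colorings 3 n" and v: "v \<in> {1..n}" and n: "2 \<le> n"
  shows "weighted_height n f (flip n v \<sigma>) = weighted_height n (refl_weight n v f) \<sigma>"
proof (cases "1 < v \<and> v < n")
  case True
  let ?p = "Transposition.transpose (v - 1) v"
  have "weighted_height n f (flip n v \<sigma>) = (\<Sum>i\<in>{1..<n}. f i * ascent \<sigma> (?p i))"
    unfolding weighted_height_def using True by (intro sum.cong refl) (simp add: ascent_flip[OF assms])
  also have "\<dots> = (\<Sum>i\<in>{1..<n}. f (?p i) * ascent \<sigma> i)"
    using True by (subst sum.permute[OF transpose_permutes_sites[of v n]]) (auto simp: o_def)
  finally show ?thesis using True by (simp add: weighted_height_def refl_weight_def)
next
  case False
  then show ?thesis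
    unfolding weighted_height_def using v
    by (intro sum.cong refl) (auto simp: ascent_flip[OF assms] refl_weight_def)
qed

lemma energy_refl: "v \<in> {1..n} \<Longrightarrow> energy n (refl_weight n v f) = energy n f"
proof (cases "1 < v \<and> v < n")
  case True
  then show ?thesis
    unfolding energy_def by (subst (2) sum.permute[OF transpose_permutes_sites[of v n]])
      (auto simp: refl_weight_def o_def)
next
  case False
  assume "v \<in> {1..n}"
  with False show ?thesis
    unfolding energy_def by (intro sum.cong refl) (auto simp: refl_weight_def)
qed

text \<open>Only the (at most two) signs next to \<open>v\<close> contribute.\<close>

lemma weighted_height_refl_diff_sq:
  assumes v: "v \<in> {1..n}" and n: "2 \<le> n"
  shows "(weighted_height n (\<lambda>i. f i - refl_weight n v f i) \<sigma>)\<^sup>2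
       \<le> 2 * energy n (\<lambda>i. f i - refl_weight n v f i)"
proof -
  let ?g = "\<lambda>i. f i - refl_weight n v f i"
  have a1: "(ascent \<sigma> i)\<^sup>2 = 1" for i by (simp add: ascent_def)
  define J where "J = (if v = 1 then {1} else if v = n then {n - 1} else {v - 1, v})"
  have J: "J \<subseteq> {1..<n}" "\<forall>i\<in>{1..<n} - J. ?g i = 0"
    using v n by (auto simp: J_def refl_weight_def Transposition.transpose_def split: if_splits)
  have h: "weighted_height n ?g \<sigma> = (\<Sum>i\<in>J. ?g i * ascent \<sigma> i)"
    unfolding weighted_height_def using J by (intro sum.mono_neutral_right) auto
  have e: "energy n ?g = (\<Sum>i\<in>J. (?g i)\<^sup>2)"
    unfolding energy_def using J by (intro sum.mono_neutral_right) auto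
  have "(\<Sum>i\<in>J. ?g i * ascent \<sigma> i)\<^sup>2 \<le> (\<Sum>i\<in>J. (?g i)\<^sup>2) * (\<Sum>i\<in>J. (ascent \<sigma> i)\<^sup>2)"
    by (rule Cauchy_Schwarz_ineq_sum)
  also have "(\<Sum>i\<in>J. (ascent \<sigma> i)\<^sup>2) = real (card J)" by (simp add: a1)
  also have "(\<Sum>i\<in>J. (?g i)\<^sup>2) * real (card J) \<le> (\<Sum>i\<in>J. (?g i)\<^sup>2) * 2"
    by (intro mult_left_mono sum_nonneg) (auto simp: J_def card_insert_if)
  finally show ?thesis unfolding h e by simp
qed

text \<open>The reflection is an isometry, so averaging \<open>f\<close> with its reflection loses energy in proportion
  to their squared distance.\<close>

lemma energy_drop:
  assumes "v \<in> {1..n}"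
  shows "9 * (energy n f - energy n (avg_weight n v f))
       = 2 * energy n (\<lambda>i. f i - refl_weight n v f i)"
proof -
  let ?r = "refl_weight n v f"
  have "9 * ((f i)\<^sup>2 - (avg_weight n v f i)\<^sup>2) = 2 * (f i - ?r i)\<^sup>2 + 3 * ((f i)\<^sup>2 - (?r i)\<^sup>2)" for i
    by (simp add: avg_weight_def power2_eq_square field_simps)
  then have "(\<Sum>i\<in>{1..<n}. 9 * ((f i)\<^sup>2 - (avg_weight n v f i)\<^sup>2))
      = (\<Sum>i\<in>{1..<n}. 2 * (f i - ?r i)\<^sup>2 + 3 * ((f i)\<^sup>2 - (?r i)\<^sup>2))" by (simp only:)
  then have "9 * (energy n f - energy n (avg_weight n v f))
      = 2 * energy n (\<lambda>i. f i - ?r i) + 3 * (energy n f - energy n ?r)"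
    unfolding energy_def by (simp add: sum.distrib sum_subtractf flip: sum_distrib_left)
  then show ?thesis using energy_refl[OF assms, of f] by simp
qed

text \<open>The conditional variance of one update is \<open>2/9\<close> times the square of the change of
  \<^term>\<open>weighted_height n f\<close> under the flip. It is paid for by the energy that the averaging of
  \<open>f\<close> dissipates; such bounds telescope over any sequence of updates.\<close>

lemma metropolis_moments:
  fixes f :: "nat \<Rightarrow> real"
  assumes \<sigma>: "\<sigma> \<in> proper_colorings 3 n" and v: "v \<in> {1..n}" and n: "2 \<le> n"
  defines "g \<equiv> avg_weight n v f"
  shows "measure_pmf.expectation (metropolis 3 n v \<sigma>) (weighted_height n f) = weighted_height n g \<sigma>"
    and "measure_pmf.expectation (metropolis 3 n v \<sigma>) (\<lambda>\<tau>. (weighted_height n f \<tau>)\<^sup>2)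
       \<le> (weighted_height n g \<sigma>)\<^sup>2 + 2 * (energy n f - energy n g)"
proof -
  define x y where "x = weighted_height n f \<sigma>" and "y = weighted_height n (refl_weight n v f) \<sigma>"
  have g: "weighted_height n g \<sigma> = (2 * x + y) / 3"
    by (simp add: g_def avg_weight_def x_def y_def weighted_height_def sum.distrib sum_distrib_left
        sum_divide_distrib add_divide_distrib distrib_right mult.assoc)
  have d: "weighted_height n (\<lambda>i. f i - refl_weight n v f i) \<sigma> = x - y"
    by (simp add: x_def y_def weighted_height_def sum_subtractf left_diff_distrib)
  show "measure_pmf.expectation (metropolis 3 n v \<sigma>) (weighted_height n f) = weighted_height n g \<sigma>"
    unfolding g expectation_metropolis[OF \<sigma> v n] by (simp add: weighted_height_flip[OF \<sigma> v n] x_def y_def)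
  have "measure_pmf.expectation (metropolis 3 n v \<sigma>) (\<lambda>\<tau>. (weighted_height n f \<tau>)\<^sup>2)
      = (2 * x\<^sup>2 + y\<^sup>2) / 3"
    unfolding expectation_metropolis[OF \<sigma> v n] by (simp add: weighted_height_flip[OF \<sigma> v n] x_def y_def)
  also have "\<dots> = ((2 * x + y) / 3)\<^sup>2 + 2 / 9 * (x - y)\<^sup>2"
    by (simp add: power2_eq_square field_simps)
  also have "\<dots> \<le> ((2 * x + y) / 3)\<^sup>2 + 2 * (energy n f - energy n g)"
    using weighted_height_refl_diff_sq[OF v n, of f \<sigma>] energy_drop[OF v, of f]
    unfolding d g_def by linarith
  finally show "measure_pmf.expectation (metropolis 3 n v \<sigma>) (\<lambda>\<tau>. (weighted_height n f \<tau>)\<^sup>2)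
       \<le> (weighted_height n g \<sigma>)\<^sup>2 + 2 * (energy n f - energy n g)" unfolding g .
qed

lemma partial_scan_moments:
  assumes \<sigma>: "\<sigma> \<in> proper_colorings 3 n" and n: "2 \<le> n" and vs: "set vs \<subseteq> {1..n}"
  shows "measure_pmf.expectation (partial_scan 3 n vs \<sigma>) (weighted_height n f)
       = weighted_height n (foldr (avg_weight n) vs f) \<sigma>
     \<and> measure_pmf.expectation (partial_scan 3 n vs \<sigma>) (\<lambda>\<tau>. (weighted_height n f \<tau>)\<^sup>2)
       \<le> (weighted_height n (foldr (avg_weight n) vs f) \<sigma>)\<^sup>2
         + 2 * (energy n f - energy n (foldr (avg_weight n) vs f))"
  using vs
proof (induction vs arbitrary: f rule: rev_induct)
  case Nil
  show ?case by (simp add: partial_scan_Nil)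
next
  case (snoc v vs)
  let ?S = "proper_colorings 3 n" and ?p = "partial_scan 3 n vs \<sigma>"
  let ?g = "avg_weight n v f"
  let ?h = "foldr (avg_weight n) vs ?g"
  have v: "v \<in> {1..n}" and vs: "set vs \<subseteq> {1..n}" using snoc.prems by auto
  note fin = finite_proper_colorings[of 3 n]
  have p: "set_pmf ?p \<subseteq> ?S" by (rule partial_scan_closed[OF _ \<sigma> vs]) simp
  have bind: "measure_pmf.expectation (partial_scan 3 n (vs @ [v]) \<sigma>) \<phi>
      = measure_pmf.expectation ?p (\<lambda>\<tau>. measure_pmf.expectation (metropolis 3 n v \<tau>) \<phi>)"
    for \<phi> :: "_ \<Rightarrow> real"
    unfolding partial_scan_snoc
    by (rule expectation_bind[OF fin p]) (rule metropolis_closed[OF _ _ v]; simp)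
  have "measure_pmf.expectation (partial_scan 3 n (vs @ [v]) \<sigma>) (weighted_height n f)
      = measure_pmf.expectation ?p (weighted_height n ?g)"
    unfolding bind by (rule expectation_cong[OF fin p]) (rule metropolis_moments(1)[OF _ v n])
  also have "\<dots> = weighted_height n ?h \<sigma>" using snoc.IH[OF vs] by blast
  finally have 1: "measure_pmf.expectation (partial_scan 3 n (vs @ [v]) \<sigma>) (weighted_height n f)
      = weighted_height n ?h \<sigma>" .
  have "measure_pmf.expectation (partial_scan 3 n (vs @ [v]) \<sigma>) (\<lambda>\<tau>. (weighted_height n f \<tau>)\<^sup>2)
      \<le> measure_pmf.expectation ?p
          (\<lambda>\<tau>. 1 * (weighted_height n ?g \<tau>)\<^sup>2 + 2 * (energy n f - energy n ?g))"
    unfolding bind mult_1 by (rule expectation_mono[OF fin p]) (rule metropolis_moments(2)[OF _ v n])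
  also have "\<dots> = measure_pmf.expectation ?p (\<lambda>\<tau>. (weighted_height n ?g \<tau>)\<^sup>2)
      + 2 * (energy n f - energy n ?g)"
    by (subst expectation_affine[OF fin p]) simp
  also have "\<dots> \<le> (weighted_height n ?h \<sigma>)\<^sup>2 + 2 * (energy n f - energy n ?h)"
    using snoc.IH[OF vs, of ?g] by simp
  finally show ?case using 1 by simp
qed

section \<open>Eigenvectors of a sweep\<close>

lemma weighted_height_cong:
  "(\<And>i. i \<in> {1..<n} \<Longrightarrow> f i = g i) \<Longrightarrow> weighted_height n f \<sigma> = weighted_height n g \<sigma>"
  by (simp add: weighted_height_def)

lemma energy_cong:
  "(\<And>i. i \<in> {1..<n} \<Longrightarrow> f i = g i) \<Longrightarrow> energy n f = energy n g"
  by (simp add: energy_def)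

lemma weighted_height_scale: "weighted_height n (\<lambda>i. c * f i) \<sigma> = c * weighted_height n f \<sigma>"
  by (simp add: weighted_height_def sum_distrib_left mult.assoc)

lemma energy_scale: "energy n (\<lambda>i. c * f i) = c\<^sup>2 * energy n f"
  by (simp add: energy_def sum_distrib_left power_mult_distrib)

text \<open>A sweep acts on weights by the averaging operators, the one of the last vertex \<open>n\<close> first.
  While they are applied, a value \<open>h\<close> is carried from right to left: the average at \<open>v\<close> replaces the
  weight at \<open>v\<close> by its final value \<open>m * f v\<close> and leaves \<open>h (v - 1)\<close> at \<open>v - 1\<close>. The final values determine
  \<open>h\<close>, and its recursion becomes a three-term recurrence for \<open>f\<close>. The values
  of \<open>f\<close> at \<open>0\<close> and \<open>n\<close> are extrapolated by that recurrence and encode the two ends of the path.\<close>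

lemma sweep_eigenvector:
  fixes f :: "nat \<Rightarrow> real"
  assumes n: "2 \<le> n"
    and rec: "\<And>i. 1 \<le> i \<Longrightarrow> i < n \<Longrightarrow> m * f (Suc i) = (3 * m - 1) * f i - f (i - 1)"
    and left: "f 0 = - 3 * m * f 1"
    and right: "3 * m * f n = - f (n - 1)"
    and i: "i \<in> {1..<n}"
  shows "foldr (avg_weight n) [1..<n + 1] f i = m * f i"
proof -
  define h where "h i = (3 * m * f i - f (i - 1)) / 2" for i
  have h_rec: "h i = (2 * f i + h (Suc i)) / 3" if "1 \<le> i" "i < n" for i
  proof -
    have solve: "(3 * x - a) / 2 = (2 * y + (3 * z - y) / 2) / 3" if "z = 3 * x - y - a" for a x y z :: real
      using that by (simp add: field_simps)
    have eq: "m * f (Suc i) = 3 * (m * f i) - f i - f (i - 1)"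
      using rec[OF that] by (simp add: algebra_simps)
    have hs: "h i = (3 * (m * f i) - f (i - 1)) / 2" "h (Suc i) = (3 * (m * f (Suc i)) - f i) / 2"
      by (simp_all add: h_def mult.assoc)
    show ?thesis unfolding hs by (rule solve[OF eq])
  qed
  have h_mix: "(f (i - 1) + 2 * h i) / 3 = m * f i" for i
    by (simp add: h_def field_simps)
  have h_last: "h (n - 1) = f (n - 1) / 3"
  proof -
    have "h (n - 1) = (2 * f (n - 1) + h n) / 3" using h_rec[of "n - 1"] n by simp
    moreover have "h n = - f (n - 1)" using right by (simp add: h_def)
    ultimately show ?thesis by simp
  qed
  have h_first: "h 1 = 3 * m * f 1" using left by (simp add: h_def)
  \<comment> \<open>The weights after the averages at \<open>n\<close>, ..., \<open>v\<close>.\<close>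
  define state where
    "state v i = (if i < v - 1 then f i else if i = v - 1 then h i else if i < n then m * f i else f i)" for v i
  have partial: "foldr (avg_weight n) [v..<n + 1] f = state v" if "2 \<le> v" "v \<le> n" for v
    using that(2,1)
  proof (induction v rule: inc_induct)
    case base
    show ?case
    proof
      fix i
      show "foldr (avg_weight n) [n..<n + 1] f i = state n i"
        using base n h_last by (auto simp: avg_weight_def refl_weight_def state_def)
    qed
  next
    case (step v)
    obtain k where k: "v = Suc k" "1 \<le> k" using step.prems by (cases v) auto
    have "[v..<n + 1] = v # [Suc v..<n + 1]" using step.hyps by (simp add: upt_conv_Cons)
    then have "foldr (avg_weight n) [v..<n + 1] f = avg_weight n v (state (Suc v))"
      using step by simp
    also have "\<dots> = state v"
    proof
      fix i
      have a: "state (Suc v) k = f k" "state (Suc v) v = h v"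
        using k by (simp_all add: state_def)
      have b: "state v k = h k" "state v v = m * f v"
        using k step.hyps by (simp_all add: state_def)
      have r: "refl_weight n (Suc k) g = g \<circ> Transposition.transpose k (Suc k)" for g
        using k step.hyps by (simp add: refl_weight_def)
      consider "i = k" | "i = v" | "i \<noteq> k" "i \<noteq> v" by blast
      then show "avg_weight n v (state (Suc v)) i = state v i"
      proof cases
        case 1
        then show ?thesis using a b h_rec[of k] k step.hyps
          by (simp add: avg_weight_def r)
      next
        case 2
        then show ?thesis using a b h_mix[of v] k
          by (simp add: avg_weight_def r)
      next
        case 3
        then have "state (Suc v) i = state v i" using k by (auto simp: state_def)
        then show ?thesis using 3 k by (simp add: avg_weight_def r)
      qed
    qed
    finally show ?case .
  qed
  have "[1..<n + 1] = 1 # [2..<n + 1]" using n by (simp add: upt_conv_Cons numeral_2_eq_2)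
  then have "foldr (avg_weight n) [1..<n + 1] f = avg_weight n 1 (state 2)"
    using partial[of 2] n by simp
  then show ?thesis
    using i h_first by (auto simp: avg_weight_def refl_weight_def state_def)
qed

lemma scan_eigenvector_moments:
  fixes f :: "nat \<Rightarrow> real"
  assumes \<sigma>: "\<sigma> \<in> proper_colorings 3 n" and n: "2 \<le> n"
    and eig: "\<And>i. i \<in> {1..<n} \<Longrightarrow> foldr (avg_weight n) [1..<n + 1] f i = m * f i"
  shows "measure_pmf.expectation (systematic_scan 3 n \<sigma>) (weighted_height n f)
       = m * weighted_height n f \<sigma>"
    and "measure_pmf.expectation (systematic_scan 3 n \<sigma>) (\<lambda>\<tau>. (weighted_height n f \<tau>)\<^sup>2)
       \<le> m\<^sup>2 * (weighted_height n f \<sigma>)\<^sup>2 + 2 * energy n f * (1 - m\<^sup>2)"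
proof -
  let ?g = "foldr (avg_weight n) [1..<n + 1] f"
  have w: "weighted_height n ?g \<sigma> = m * weighted_height n f \<sigma>"
    by (subst weighted_height_scale[symmetric]) (intro weighted_height_cong eig)
  have e: "energy n ?g = m\<^sup>2 * energy n f"
    by (subst energy_scale[symmetric]) (intro energy_cong eig)
  have "set [1..<n + 1] \<subseteq> {1..n}" by auto
  note mom = partial_scan_moments[OF \<sigma> n this, of f, unfolded w e, folded systematic_scan_eq]
  show "measure_pmf.expectation (systematic_scan 3 n \<sigma>) (weighted_height n f)
       = m * weighted_height n f \<sigma>" using mom by blast
  show "measure_pmf.expectation (systematic_scan 3 n \<sigma>) (\<lambda>\<tau>. (weighted_height n f \<tau>)\<^sup>2)
       \<le> m\<^sup>2 * (weighted_height n f \<sigma>)\<^sup>2 + 2 * energy n f * (1 - m\<^sup>2)"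
    using mom by (simp add: power_mult_distrib algebra_simps)
qed

definition ascending :: "nat \<Rightarrow> nat \<Rightarrow> nat" where
  "ascending n = (\<lambda>i\<in>{1..n}. i mod 3)"

lemma ascending_proper: "ascending n \<in> proper_colorings 3 n"
proof -
  have "i mod 3 \<noteq> Suc i mod 3" for i :: nat by presburger
  then show ?thesis by (auto simp: ascending_def proper_colorings_iff)
qed

text \<open>The coloring of maximal height: all signs are \<open>+1\<close>, so the initial value of a functional with
  nonnegative weights is as large as possible.\<close>

lemma weighted_height_ascending: "weighted_height n f (ascending n) = sum f {1..<n}"
  unfolding weighted_height_def
  by (intro sum.cong refl) (auto simp: ascent_def ascending_def mod_Suc_eq)

text \<open>The variance is at most \<open>V = 2 energy f \<le> 2 F sum f\<close>, and the mean after \<open>t\<close> sweeps, starting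
  from the ascending coloring, is \<open>m\<^sup>t sum f\<close>. Wilson's condition that its square exceeds \<open>4 V\<close> thus
  simplifies by a factor \<open>sum f\<close>.\<close>

lemma mix_systematic_scan_ge:
  fixes f :: "nat \<Rightarrow> real"
  assumes n: "2 \<le> n" and m: "0 < m" "m < 1"
    and eig: "\<And>i. i \<in> {1..<n} \<Longrightarrow> foldr (avg_weight n) [1..<n + 1] f i = m * f i"
    and f: "\<And>i. i \<in> {1..<n} \<Longrightarrow> 0 \<le> f i \<and> f i \<le> F"
    and large: "\<And>t. real t < T \<Longrightarrow> 8 * F < (m ^ t)\<^sup>2 * sum f {1..<n}"
  shows "T \<le> real (mix (proper_colorings 3 n) (systematic_scan 3 n)
                  (pmf_of_set (proper_colorings 3 n)) (1/2))"
proof -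
  let ?S = "proper_colorings 3 n" and ?P = "systematic_scan 3 n"
  let ?\<mu> = "pmf_of_set ?S"
  note fin = finite_proper_colorings[of 3 n]
  have ne: "?S \<noteq> {}" using ascending_proper by blast
  have all: "set [1..<n + 1] \<subseteq> {1..n}" by auto
  have closed: "set_pmf (?P \<sigma>) \<subseteq> ?S" if "\<sigma> \<in> ?S" for \<sigma>
    unfolding systematic_scan_eq by (rule partial_scan_closed[OF _ that all]) simp
  have \<mu>: "set_pmf ?\<mu> \<subseteq> ?S" "bind_pmf ?\<mu> ?P = ?\<mu>"
    using fin ne uniform_stationary_scan[OF n ne] by simp_all
  define Z where "Z = sum f {1..<n}"
  show ?thesis
  proof (rule mix_ge[OF fin ascending_proper])
    show "\<exists>t>0. tv_dist ?S (kernel_power ?P t (ascending n)) ?\<mu> \<le> 1/2"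
    proof (rule tv_dist_eventually_small[OF fin closed _ _ \<mu> ascending_proper])
      show "\<sigma> \<in> set_pmf (?P \<sigma>)" if "\<sigma> \<in> ?S" for \<sigma>
        unfolding systematic_scan_eq by (rule partial_scan_lazy[OF that all])
      show "(\<sigma>, \<tau>) \<in> {(\<sigma>, \<tau>). \<sigma> \<in> ?S \<and> \<tau> \<in> set_pmf (?P \<sigma>)}\<^sup>*" if "\<sigma> \<in> ?S" "\<tau> \<in> ?S" for \<sigma> \<tau>
        using scan_irreducible[OF that n] unfolding scan_moves_def .
    qed auto
    fix t assume t: "real t < T"
    have F0: "0 \<le> F" using f[of 1] n by auto
    have "energy n f \<le> (\<Sum>i\<in>{1..<n}. F * f i)"
      unfolding energy_def power2_eq_square by (intro sum_mono mult_right_mono) (use f in auto)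
    then have en: "energy n f \<le> F * Z" by (simp add: Z_def sum_distrib_left)
    have big: "8 * F < (m ^ t)\<^sup>2 * Z" using large[OF t] by (simp add: Z_def)
    have Z0: "0 < Z"
    proof (rule ccontr)
      assume "\<not> 0 < Z"
      then have "(m ^ t)\<^sup>2 * Z \<le> 0" by (intro mult_nonneg_nonpos) auto
      with big F0 show False by simp
    qed
    show "1/2 < tv_dist ?S (kernel_power ?P t (ascending n)) ?\<mu>"
    proof (rule tv_dist_eigenfunction_gt_half[OF fin closed _ _ \<mu> _ m(2) ascending_proper])
      show "measure_pmf.expectation (?P \<sigma>) (weighted_height n f) = m * weighted_height n f \<sigma>"
        if "\<sigma> \<in> ?S" for \<sigma> by (rule scan_eigenvector_moments(1)[OF that n eig])
      show "measure_pmf.expectation (?P \<sigma>) (\<lambda>\<tau>. (weighted_height n f \<tau>)\<^sup>2)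
          \<le> m\<^sup>2 * (weighted_height n f \<sigma>)\<^sup>2 + 2 * energy n f * (1 - m\<^sup>2)"
        if "\<sigma> \<in> ?S" for \<sigma> by (rule scan_eigenvector_moments(2)[OF that n eig])
      show "0 \<le> m" using m by simp
      show "0 \<le> 2 * energy n f" by (simp add: energy_def sum_nonneg)
      have "4 * (2 * energy n f) \<le> 8 * F * Z" using en by simp
      also have "\<dots> < (m ^ t)\<^sup>2 * Z * Z" using big Z0 by simp
      also have "\<dots> = (m ^ t * weighted_height n f (ascending n))\<^sup>2"
        by (simp add: weighted_height_ascending Z_def power2_eq_square)
      finally show "4 * (2 * energy n f) < (m ^ t * weighted_height n f (ascending n))\<^sup>2" .
    qed
  qed
qed

section \<open>The leading eigenvector\<close>

text \<open>The square root \<open>s\<close> of the eigenvalue of a sweep at frequency \<open>\<theta>\<close>. The three-term recurrence with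
  \<open>m = s\<^sup>2\<close> is solved by \<open>s\<^bsup>-i\<^esup> sin (\<theta> i + c)\<close> exactly if \<open>3 s\<^sup>2 - 1 = 2 s cos \<theta>\<close>, and \<open>s\<close> is the positive
  root.\<close>

definition decay_root :: "real \<Rightarrow> real" where
  "decay_root \<theta> = (cos \<theta> + sqrt ((cos \<theta>)\<^sup>2 + 3)) / 3"

lemma decay_root_eq: "3 * (decay_root \<theta>)\<^sup>2 = 2 * decay_root \<theta> * cos \<theta> + 1"
proof -
  have "(sqrt ((cos \<theta>)\<^sup>2 + 3))\<^sup>2 = (cos \<theta>)\<^sup>2 + 3" by (simp add: add_nonneg_nonneg)
  then show ?thesis by (simp add: decay_root_def power2_eq_square field_simps)
qed

lemma decay_root_pos: "0 < decay_root \<theta>"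
proof -
  have "\<bar>cos \<theta>\<bar> < sqrt ((cos \<theta>)\<^sup>2 + 3)" by (rule real_less_rsqrt) simp
  then show ?thesis by (simp add: decay_root_def)
qed

lemma decay_root_less_1:
  assumes "0 < \<theta>" "\<theta> \<le> pi"
  shows "decay_root \<theta> < 1"
proof (rule ccontr)
  define s where "s = decay_root \<theta>"
  assume "\<not> decay_root \<theta> < 1"
  then have s: "1 \<le> s" by (simp add: s_def)
  have "cos \<theta> < cos 0" using assms by (intro cos_monotone_0_pi) auto
  then have "s * cos \<theta> < s" using s by simp
  then have "3 * s\<^sup>2 < 2 * s + 1" using decay_root_eq[of \<theta>] by (simp add: s_def mult.assoc)
  moreover have "s \<le> s\<^sup>2" using s by (simp add: power2_eq_square)
  ultimately show False using s by linarith
qed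

text \<open>To leading order \<open>s = 1 - \<theta>\<^sup>2 / 4\<close>. The form of the error is chosen so that for \<open>\<theta> = \<pi> / (n - 1)\<close>
  four times the exponent, \<open>\<theta>\<^sup>2 / (1 - \<theta>\<^sup>2)\<close>, is the closed expression \<open>\<pi>\<^sup>2 / ((n - 1)\<^sup>2 - \<pi>\<^sup>2)\<close>.\<close>

lemma inverse_decay_root_le:
  assumes "0 < \<theta>" "\<theta> < 1"
  shows "1 / decay_root \<theta> \<le> exp (\<theta>\<^sup>2 / (4 * (1 - \<theta>\<^sup>2)))"
proof -
  define b where "b = 1 - decay_root \<theta>"
  have s: "decay_root \<theta> = 1 - b" by (simp add: b_def)
  have \<theta>2: "\<theta>\<^sup>2 < 1" using assms by (simp add: power_less_one_iff)
  have b: "0 < b" "b < 1"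
    using decay_root_less_1[of \<theta>] decay_root_pos[of \<theta>] assms pi_gt3 by (auto simp: b_def)
  have eq: "b * (6 - 2 * cos \<theta> - 3 * b) = 2 * (1 - cos \<theta>)"
    using decay_root_eq[of \<theta>] unfolding s by (simp add: power2_eq_square algebra_simps)
  have "b * (4 - 3 * b) \<le> b * (6 - 2 * cos \<theta> - 3 * b)"
    using b cos_le_one[of \<theta>] by (intro mult_left_mono) (linarith, simp)
  also have "\<dots> \<le> \<theta>\<^sup>2"
  proof -
    have "1 - cos \<theta> = 2 * (sin (\<theta> / 2))\<^sup>2" using cos_double_sin[of "\<theta> / 2"] by simp
    moreover have "(sin (\<theta> / 2))\<^sup>2 \<le> (\<theta> / 2)\<^sup>2"
      using abs_sin_x_le_abs_x[of "\<theta> / 2"] by (metis abs_ge_zero power2_abs power_mono)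
    ultimately show ?thesis unfolding eq by (simp add: power_divide)
  qed
  finally have main: "b * (4 - 3 * b) \<le> \<theta>\<^sup>2" .
  have "b * 1 \<le> b * (4 - 3 * b)" using b by (intro mult_left_mono) auto
  then have "b \<le> \<theta>\<^sup>2" using main by simp
  then have "b * (4 - 3 * \<theta>\<^sup>2) \<le> b * (4 - 3 * b)" using b by (intro mult_left_mono) auto
  then have b_le: "b * (4 - 3 * \<theta>\<^sup>2) \<le> \<theta>\<^sup>2" using main by linarith
  have "1 / decay_root \<theta> = 1 + b / (1 - b)" using b by (simp add: s field_simps)
  also have "b / (1 - b) \<le> \<theta>\<^sup>2 / (4 * (1 - \<theta>\<^sup>2))"
    using b \<theta>2 b_le by (simp add: divide_simps) (simp add: algebra_simps)
  also have "1 + \<theta>\<^sup>2 / (4 * (1 - \<theta>\<^sup>2)) \<le> exp (\<theta>\<^sup>2 / (4 * (1 - \<theta>\<^sup>2)))" by (rule exp_ge_add_one_self)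
  finally show ?thesis by simp
qed

text \<open>The combination of sine and cosine waves that satisfies the condition at the left end of the
  path. Up to a constant factor its numerator is \<open>sin (\<theta> (i - a))\<close> for some \<open>a\<close> between \<open>0\<close> and \<open>1\<close>, and the condition
  at the right end asks for another zero at \<open>a + n - 1\<close>; this is why \<open>\<theta> = \<pi> / (n - 1)\<close>
  is an exact frequency. The power of \<open>s\<close> reflects the left-to-right order of the scan.\<close>

definition scan_eigenvector :: "real \<Rightarrow> nat \<Rightarrow> real" where
  "scan_eigenvector \<theta> i =
     (sin (\<theta> * real i) + 3 * decay_root \<theta> * sin (\<theta> * (real i - 1))) / decay_root \<theta> ^ i"

lemma scan_eigenvector_is_eigenvector:
  assumes n: "2 \<le> n" and \<theta>: "\<theta> = pi / (real n - 1)" and i: "i \<in> {1..<n}"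
  shows "foldr (avg_weight n) [1..<n + 1] (scan_eigenvector \<theta>) i
       = (decay_root \<theta>)\<^sup>2 * scan_eigenvector \<theta> i"
proof (rule sweep_eigenvector[OF n _ _ _ i])
  define s where "s = decay_root \<theta>"
  have s0: "s \<noteq> 0" using decay_root_pos[of \<theta>] by (simp add: s_def)
  have s_eq: "3 * s\<^sup>2 - 1 = 2 * s * cos \<theta>" using decay_root_eq[of \<theta>] by (simp add: s_def)
  define u where "u x = sin (\<theta> * x) + 3 * s * sin (\<theta> * (x - 1))" for x
  have f: "scan_eigenvector \<theta> i = u (real i) / s ^ i" for i
    by (simp add: scan_eigenvector_def u_def s_def)
  have u: "u (x + 1) + u (x - 1) = 2 * cos \<theta> * u x" for x
  proof -
    have sin_rec: "sin (\<theta> * (y + 1)) + sin (\<theta> * (y - 1)) = 2 * cos \<theta> * sin (\<theta> * y)" for y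
      by (simp add: distrib_left right_diff_distrib sin_add sin_diff)
    have "u (x + 1) + u (x - 1) = (sin (\<theta> * (x + 1)) + sin (\<theta> * (x - 1)))
        + 3 * s * (sin (\<theta> * ((x - 1) + 1)) + sin (\<theta> * ((x - 1) - 1)))"
      by (simp add: u_def distrib_left[of "3 * s"])
    also have "\<dots> = 2 * cos \<theta> * u x"
      unfolding sin_rec by (simp only: u_def distrib_left mult_ac)
    finally show ?thesis .
  qed
  show "(decay_root \<theta>)\<^sup>2 * scan_eigenvector \<theta> (Suc i)
      = (3 * (decay_root \<theta>)\<^sup>2 - 1) * scan_eigenvector \<theta> i - scan_eigenvector \<theta> (i - 1)"
    if i: "1 \<le> i" "i < n" for i
  proof -
    obtain k where k: "i = Suc k" using i by (cases i) auto
    have "u (real (Suc (Suc k))) = 2 * cos \<theta> * u (real (Suc k)) - u (real k)"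
      using u[of "real (Suc k)"] by (simp add: algebra_simps)
    then have "s\<^sup>2 * (u (real (Suc (Suc k))) / s ^ Suc (Suc k))
        = (2 * cos \<theta> * u (real (Suc k)) - u (real k)) / s ^ k"
      using s0 by (simp add: power2_eq_square)
    also have "\<dots> = 2 * s * cos \<theta> * (u (real (Suc k)) / s ^ Suc k) - u (real k) / s ^ k"
      using s0 by (simp add: field_simps)
    finally show ?thesis unfolding s_def[symmetric] s_eq f k diff_Suc_1 .
  qed
  show "scan_eigenvector \<theta> 0 = - 3 * (decay_root \<theta>)\<^sup>2 * scan_eigenvector \<theta> 1"
    unfolding s_def[symmetric] f using s0 by (simp add: u_def power2_eq_square)
  show "3 * (decay_root \<theta>)\<^sup>2 * scan_eigenvector \<theta> n = - scan_eigenvector \<theta> (n - 1)"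
  proof -
    obtain k where k: "n = Suc k" "1 \<le> k" using n by (cases n) auto
    have k\<theta>: "\<theta> * real k = pi" using k by (simp add: \<theta>)
    have "u (real k + 1) = - sin \<theta>"
      using k\<theta> by (simp add: u_def distrib_left sin_add)
    moreover have "u (real k) = 3 * s * sin \<theta>"
      using k\<theta> by (simp add: u_def right_diff_distrib sin_diff)
    ultimately show ?thesis
      unfolding s_def[symmetric] f k using s0 by (simp add: power2_eq_square add.commute)
  qed
qed

text \<open>The factor \<open>s\<^bsup>-i\<^esup>\<close> lies between \<open>1\<close> and a constant, because \<open>s < 1\<close> and \<open>n \<theta>\<^sup>2\<close> is bounded.\<close>

lemma scan_eigenvector_bounds:
  assumes n: "8 \<le> n" and \<theta>: "\<theta> = pi / (real n - 1)" and i: "i \<in> {1..<n}"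
  shows "sin (\<theta> * real i) \<le> scan_eigenvector \<theta> i" "0 \<le> sin (\<theta> * real i)"
    "scan_eigenvector \<theta> i \<le> 4 * exp 1"
proof -
  define s where "s = decay_root \<theta>"
  have pi: "3 < pi" "pi < 4" using pi_gt3 pi_less_4 by auto
  have \<theta>0: "0 < \<theta>" "\<theta> < 1" using n pi by (auto simp: \<theta>)
  have s: "0 < s" "s < 1" using decay_root_pos decay_root_less_1[of \<theta>] \<theta>0 pi by (auto simp: s_def)
  have \<theta>n: "\<theta> * (real n - 1) = pi" using n by (simp add: \<theta>)
  have sin_nonneg: "0 \<le> sin (\<theta> * x)" if "0 \<le> x" "x \<le> real n - 1" for x
  proof (rule sin_ge_zero)
    show "0 \<le> \<theta> * x" using that \<theta>0 by simp
    have "\<theta> * x \<le> \<theta> * (real n - 1)" using that \<theta>0 by (intro mult_left_mono) auto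
    then show "\<theta> * x \<le> pi" using \<theta>n by simp
  qed
  have i1: "0 \<le> real i - 1" "real i \<le> real n - 1" using i by auto
  show s1: "0 \<le> sin (\<theta> * real i)" using i1 by (intro sin_nonneg) auto
  have s2: "0 \<le> sin (\<theta> * (real i - 1))" using i1 by (intro sin_nonneg) auto
  let ?u = "sin (\<theta> * real i) + 3 * s * sin (\<theta> * (real i - 1))"
  have f: "scan_eigenvector \<theta> i = ?u / s ^ i" by (simp add: scan_eigenvector_def s_def)
  have u_ge: "sin (\<theta> * real i) \<le> ?u" using s2 s by simp
  have "?u * 1 \<le> ?u * (1 / s ^ i)"
    using s u_ge s1 by (intro mult_left_mono) (auto simp: power_le_one)
  then show "sin (\<theta> * real i) \<le> scan_eigenvector \<theta> i" using u_ge unfolding f by simp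
  have "s * sin (\<theta> * (real i - 1)) \<le> 1 * 1" using s s2 by (intro mult_mono) auto
  then have u_le: "?u \<le> 4" using sin_le_one[of "\<theta> * real i"] by linarith
  have "1 / s ^ i = (1 / s) ^ i" by (simp add: power_divide)
  also have "\<dots> \<le> (1 / s) ^ n" using s i by (intro power_increasing) auto
  also have "\<dots> \<le> exp (\<theta>\<^sup>2 / (4 * (1 - \<theta>\<^sup>2))) ^ n"
    using inverse_decay_root_le[OF \<theta>0] s by (intro power_mono) (auto simp: s_def)
  also have "\<dots> = exp (real n * (\<theta>\<^sup>2 / (4 * (1 - \<theta>\<^sup>2))))"
    by (rule exp_of_nat_mult[symmetric])
  also have "\<dots> \<le> exp 1"
  proof -
    define x where "x = real n - 1"
    have x: "7 \<le> x" using n by (simp add: x_def)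
    have "pi < 3.15" using pi_approx by simp
    then have pi2: "pi\<^sup>2 \<le> 10" using power_mono[of pi "3.15" 2] pi by (simp add: power2_eq_square)
    have xx: "7 * x \<le> x\<^sup>2" using x unfolding power2_eq_square by (intro mult_right_mono) auto
    have "(x + 1) * pi\<^sup>2 \<le> (x + 1) * 10" using pi2 x by (intro mult_left_mono) auto
    then have "(x + 1) * pi\<^sup>2 \<le> 4 * (x\<^sup>2 - pi\<^sup>2)" using x pi2 xx by argo
    then have le: "real n * pi\<^sup>2 \<le> 4 * ((real n - 1)\<^sup>2 - pi\<^sup>2)" by (simp add: x_def)
    have D: "0 < (real n - 1)\<^sup>2 - pi\<^sup>2" using x pi2 xx unfolding x_def[symmetric] by linarith
    have "\<theta>\<^sup>2 / (4 * (1 - \<theta>\<^sup>2)) = pi\<^sup>2 / (4 * ((real n - 1)\<^sup>2 - pi\<^sup>2))"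
      using n by (simp add: \<theta> power_divide divide_simps)
    moreover have "real n * (pi\<^sup>2 / (4 * ((real n - 1)\<^sup>2 - pi\<^sup>2))) \<le> 1"
      using le D by (simp add: pos_divide_le_eq)
    ultimately show ?thesis by simp
  qed
  finally have pow: "1 / s ^ i \<le> exp 1" .
  have "?u * (1 / s ^ i) \<le> 4 * exp 1"
    using u_le pow u_ge s1 s by (intro mult_mono) auto
  then show "scan_eigenvector \<theta> i \<le> 4 * exp 1" unfolding f by simp
qed

text \<open>Multiplication by \<open>2 sin (\<theta> / 2)\<close> makes the sum telescope; it equals \<open>cot (\<theta> / 2)\<close>.\<close>

lemma sum_sin_ge:
  assumes n: "8 \<le> n" and \<theta>: "\<theta> = pi / (real n - 1)"
  shows "(real n - 1) / pi \<le> (\<Sum>i\<in>{1..<n}. sin (\<theta> * real i))"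
proof -
  define N where "N = n - 1"
  have N: "n = Suc N" "7 \<le> N" using n by (auto simp: N_def)
  have \<theta>N: "\<theta> * real N = pi" using N by (simp add: \<theta>)
  have pi: "3 < pi" "pi < 4" using pi_gt3 pi_less_4 by auto
  have \<theta>0: "0 < \<theta>" "\<theta> < 1" using n pi by (auto simp: \<theta>)
  define X where "X = (\<Sum>i\<in>{1..<n}. sin (\<theta> * real i))"
  have "2 * sin (\<theta> / 2) * (\<Sum>i\<in>{1..<Suc k}. sin (\<theta> * real i))
      = cos (\<theta> / 2) - cos (\<theta> * real k + \<theta> / 2)" for k
  proof (induction k)
    case (Suc k)
    have "\<theta> * real (Suc k) - \<theta> / 2 = \<theta> * real k + \<theta> / 2" by (simp add: algebra_simps)
    then have "cos (\<theta> * real k + \<theta> / 2) = cos (\<theta> * real (Suc k) - \<theta> / 2)" by (simp only:)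
    then have last: "2 * sin (\<theta> / 2) * sin (\<theta> * real (Suc k))
        = cos (\<theta> * real k + \<theta> / 2) - cos (\<theta> * real (Suc k) + \<theta> / 2)"
      unfolding cos_add[of _ "\<theta> / 2"] cos_diff by simp
    have split: "(\<Sum>i\<in>{1..<Suc (Suc k)}. sin (\<theta> * real i))
        = (\<Sum>i\<in>{1..<Suc k}. sin (\<theta> * real i)) + sin (\<theta> * real (Suc k))"
      by (rule sum.atLeastLessThan_Suc) simp
    show ?case unfolding split distrib_left using Suc last by linarith
  qed simp
  from this[of N] have tel: "2 * sin (\<theta> / 2) * X = 2 * cos (\<theta> / 2)"
    by (simp add: \<theta>N X_def N cos_add)
  have s0: "0 < sin (\<theta> / 2)" using \<theta>0 pi by (intro sin_gt_zero) auto
  have "cos (pi / 3) \<le> cos (\<theta> / 2)" using \<theta>0 pi by (intro cos_monotone_0_pi_le) auto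
  then have c: "1 \<le> 2 * cos (\<theta> / 2)" by (simp add: cos_60)
  have X0: "0 \<le> X" using tel s0 c by (smt (verit) mult_nonneg_nonpos2 mult_pos_neg)
  have "1 \<le> 2 * sin (\<theta> / 2) * X" using tel c by simp
  also have "\<dots> \<le> \<theta> * X" using sin_x_le_x[of "\<theta> / 2"] \<theta>0 X0 by (intro mult_right_mono) auto
  finally have "1 / \<theta> \<le> X" using \<theta>0 by (simp add: field_simps)
  then show ?thesis by (simp add: \<theta> X_def)
qed

section \<open>The mixing time\<close>

text \<open>With \<open>sum f \<ge> (n - 1) / \<pi>\<close> and \<open>F = 4 e\<close>, the condition \<open>8 F < m\<^bsup>2 t\<^esup> sum f\<close> holds as
  long as \<open>m\<^bsup>2 t\<^esup> > 32 e \<pi> / (n - 1)\<close>, where \<open>m\<^bsup>2 t\<^esup> \<ge> exp (- t \<pi>\<^sup>2 / ((n - 1)\<^sup>2 - \<pi>\<^sup>2))\<close>.\<close>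

lemma mix_systematic_scan_explicit:
  assumes n: "8 \<le> n"
  shows "((real n - 1)\<^sup>2 - pi\<^sup>2) * (ln (real n - 1) - ln (32 * exp 1 * pi)) / pi\<^sup>2
    \<le> real (mix (proper_colorings 3 n) (systematic_scan 3 n)
                  (pmf_of_set (proper_colorings 3 n)) (1/2))"
proof -
  define \<theta> where "\<theta> = pi / (real n - 1)"
  define s where "s = decay_root \<theta>"
  let ?f = "scan_eigenvector \<theta>"
  have pi: "3 < pi" "pi < 4" using pi_gt3 pi_less_4 by auto
  have \<theta>0: "0 < \<theta>" "\<theta> < 1" using n pi by (auto simp: \<theta>_def)
  have s: "0 < s" "s < 1" using decay_root_pos decay_root_less_1[of \<theta>] \<theta>0 pi by (auto simp: s_def)
  note bounds = scan_eigenvector_bounds[OF n \<theta>_def]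
  have D: "0 < (real n - 1)\<^sup>2 - pi\<^sup>2"
    using power_strict_mono[of pi "real n - 1" 2] n pi by simp
  have "(real n - 1) / pi \<le> sum ?f {1..<n}"
    by (rule order.trans[OF sum_sin_ge[OF n \<theta>_def]]) (intro sum_mono bounds(1))
  note Z = this
  show ?thesis
  proof (rule mix_systematic_scan_ge[of n "s\<^sup>2" ?f "4 * exp 1"])
    show "2 \<le> n" using n by simp
    show "0 < s\<^sup>2" "s\<^sup>2 < 1" using s by (simp_all add: power_less_one_iff)
    show "foldr (avg_weight n) [1..<n + 1] ?f i = s\<^sup>2 * ?f i" if "i \<in> {1..<n}" for i
      unfolding s_def using n that by (intro scan_eigenvector_is_eigenvector \<theta>_def) auto
    show "0 \<le> ?f i \<and> ?f i \<le> 4 * exp 1" if "i \<in> {1..<n}" for i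
      using bounds[OF that] by linarith
    fix t assume t: "real t < ((real n - 1)\<^sup>2 - pi\<^sup>2) * (ln (real n - 1) - ln (32 * exp 1 * pi)) / pi\<^sup>2"
    define c where "c = \<theta>\<^sup>2 / (4 * (1 - \<theta>\<^sup>2))"
    have c: "4 * c = pi\<^sup>2 / ((real n - 1)\<^sup>2 - pi\<^sup>2)"
      using n by (simp add: c_def \<theta>_def power_divide divide_simps)
    have "real t * (4 * c) < ln (real n - 1) - ln (32 * exp 1 * pi)"
      unfolding c using t D pi by (simp add: field_simps)
    also have "\<dots> = ln ((real n - 1) / (32 * exp 1 * pi))"
      using n pi by (simp add: ln_div)
    finally have "exp (real t * (4 * c)) < (real n - 1) / (32 * exp 1 * pi)"
      using n pi by (subst ln_less_cancel_iff[symmetric]) auto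
    then have large: "32 * exp 1 * exp (real t * (4 * c)) < (real n - 1) / pi"
      using pi by (simp add: field_simps)
    have "(1 / s) ^ (4 * t) \<le> exp c ^ (4 * t)"
      using inverse_decay_root_le[OF \<theta>0] s by (intro power_mono) (auto simp: s_def c_def)
    also have "\<dots> = exp (real t * (4 * c))" by (simp add: mult_ac flip: exp_of_nat_mult)
    finally have "1 \<le> exp (real t * (4 * c)) * s ^ (4 * t)"
      using s by (simp add: power_divide field_simps)
    moreover have "((s\<^sup>2) ^ t)\<^sup>2 = s ^ (4 * t)" by (simp flip: power_mult)
    ultimately have one: "1 \<le> exp (real t * (4 * c)) * ((s\<^sup>2) ^ t)\<^sup>2" by simp
    have "8 * (4 * exp 1) * 1 \<le> 32 * exp 1 * (exp (real t * (4 * c)) * ((s\<^sup>2) ^ t)\<^sup>2)"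
      using mult_left_mono[OF one, of "32 * exp 1"] by simp
    also have "\<dots> = ((s\<^sup>2) ^ t)\<^sup>2 * (32 * exp 1 * exp (real t * (4 * c)))" by simp
    also have "\<dots> < ((s\<^sup>2) ^ t)\<^sup>2 * sum ?f {1..<n}"
      using large Z s by (intro mult_strict_left_mono) auto
    finally show "8 * (4 * exp 1) < ((s\<^sup>2) ^ t)\<^sup>2 * sum ?f {1..<n}" by simp
  qed
qed

text \<open>The logarithmic terms cancel to order \<open>n ln n\<close>, so that the constant \<open>C\<close> is responsible for
  the error of order \<open>n\<^sup>2\<close>.\<close>

lemma explicit_bound_asymptotics:
  fixes C :: real
  shows "(\<lambda>n. (real n)\<^sup>2 * ln (real n) / pi\<^sup>2
      - ((real n - 1)\<^sup>2 - pi\<^sup>2) * (ln (real n - 1) - C) / pi\<^sup>2) \<in> O(\<lambda>n. (real n)\<^sup>2)"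
proof -
  have leading: "(\<lambda>n. (real n)\<^sup>2 * ln (real n) - ((real n - 1)\<^sup>2 - p\<^sup>2) * ln (real n - 1)) \<in> O(\<lambda>n. (real n)\<^sup>2)"
    for p :: real by real_asymp
  have const: "(\<lambda>n. ((real n - 1)\<^sup>2 - p\<^sup>2) * C) \<in> O(\<lambda>n. (real n)\<^sup>2)" for p :: real
  proof -
    have "(\<lambda>n. (real n - 1)\<^sup>2 - p\<^sup>2) \<in> O(\<lambda>n. (real n)\<^sup>2)" by real_asymp
    then show ?thesis by (cases "C = 0") simp_all
  qed
  have "(\<lambda>n. inverse (pi\<^sup>2) * (((real n)\<^sup>2 * ln (real n)
        - ((real n - 1)\<^sup>2 - pi\<^sup>2) * ln (real n - 1)) + ((real n - 1)\<^sup>2 - pi\<^sup>2) * C)) \<in> O(\<lambda>n. (real n)\<^sup>2)"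
    by (subst landau_o.big.cmult_in_iff) (auto intro!: sum_in_bigo(1) leading const)
  then show ?thesis
    by (simp add: field_simps)
qed

theorem theorem5:
  "\<exists>g :: nat \<Rightarrow> real. g \<in> O(\<lambda>n. (real n)\<^sup>2) \<and>
     (\<forall>\<^sub>F n in sequentially.
        real (mix (proper_colorings 3 n) (systematic_scan 3 n)
                  (pmf_of_set (proper_colorings 3 n)) (1/2))
          \<ge> (real n)\<^sup>2 * ln (real n) / pi\<^sup>2 - g n)"
proof (intro exI conjI)
  let ?g = "\<lambda>n. (real n)\<^sup>2 * ln (real n) / pi\<^sup>2
      - ((real n - 1)\<^sup>2 - pi\<^sup>2) * (ln (real n - 1) - ln (32 * exp 1 * pi)) / pi\<^sup>2"
  show "?g \<in> O(\<lambda>n. (real n)\<^sup>2)" by (rule explicit_bound_asymptotics)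
  show "\<forall>\<^sub>F n in sequentially.
        real (mix (proper_colorings 3 n) (systematic_scan 3 n)
                  (pmf_of_set (proper_colorings 3 n)) (1/2))
          \<ge> (real n)\<^sup>2 * ln (real n) / pi\<^sup>2 - ?g n"
    using eventually_ge_at_top[of 8]
  proof eventually_elim
    case (elim n)
    then show ?case using mix_systematic_scan_explicit by simp
  qed
qed

end
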